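(* Let $(X,d,\mu)$ be a doubling metric measure space. For every $1\le p<\infty$, $$\mathrm{VMO}^p(X)=\overline{C_u(X)\cap\mathrm{BMO}(X)},$$ where $C_u(X)$ is the space of uniformly continuous functions on $X$ and the closure is taken in $\mathrm{BMO}(X)$ with respect to the $\mathrm{BMO}(X)$-seminorm.
   Context: A metric measure space $(X,d,\mu)$ is a metric space $(X,d)$ with more than one point, equipped with a Borel measure $\mu$ such that $0<\mu(B)<\infty$ for every ball $B\subset X$ of positive finite radius. Balls come with a prescribed center and radius $\mathrm{rad}(B)$. $\mu$ is doubling if there is $C_\mu\ge1$ with $\mu(B(x,2r))\le C_\mu\,\mu(B(x,r))$ for all $x\in X$, $0<r<\infty$; a doubling metric measure space is a metric measure space whose measure is doubling. For $f\in L^1_{\mathrm{loc}}(X)$ (integrable on balls), $1\le p<\infty$ and a ball $B$, let $f_B=\frac1{\mu(B)}\int_Bf\,d\mu$ and $\mathcal O_p(f,B)=\left(\frac1{\mu(B)}\int_B|f-f_B|^p\,d\mu\right)^{1/p}$. $\mathrm{BMO}^p(X)$ is the set of $f\in L^1_{\mathrm{loc}}(X)$ with $\|f\|_{\mathrm{BMO}^p(X)}:=\sup_B\mathcal O_p(f,B)<\infty$, supremum over all balls $B\subset X$; $\mathrm{BMO}(X):=\mathrm{BMO}^1(X)$. $\mathrm{VMO}^p(X)$ is the set of $f\in\mathrm{BMO}^p(X)$ with $\lim_{r\to0^+}\sup_{\mathrm{rad}(B)\le r}\mathcal O_p(f,B)=0$, the supremum being over all balls of radius at most $r$. Functions equal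 almost everywhere are identified. *)

theory Defs
  imports "HOL-Analysis.Analysis"
begin

(* The space X is the whole type 'a; balls are the open balls "ball x r" with r > 0. *)

locale metric_measure_space =
  fixes M :: "'a::metric_space measure"
  assumes more_than_one_point: "\<exists>x y :: 'a. x \<noteq> y"
    and sets_eq_borel: "sets M = sets borel"
    and emeasure_ball_pos: "0 < r \<Longrightarrow> 0 < emeasure M (ball x r)"
    and emeasure_ball_finite: "0 < r \<Longrightarrow> emeasure M (ball x r) < \<infinity>"

locale doubling_metric_measure_space = metric_measure_space +
  assumes doubling: "\<exists>C\<ge>1::real. \<forall>x r. 0 < r \<longrightarrow>
    emeasure M (ball x (2 * r)) \<le> ennreal C * emeasure M (ball x r)"

definition L1_loc :: "'a::metric_space measure \<Rightarrow> ('a \<Rightarrow> real) set" where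
  "L1_loc M = {f. \<forall>x r. 0 < r \<longrightarrow> set_integrable M (ball x r) f}"

definition ball_avg :: "'a::metric_space measure \<Rightarrow> ('a \<Rightarrow> real) \<Rightarrow> 'a set \<Rightarrow> real" where
  "ball_avg M f B = (LINT y:B|M. f y) / measure M B"

(* Real powers a^q, q > 0, on [0,\<infinity>]; the library only has them on the reals. *)
definition ennpowr :: "ennreal \<Rightarrow> real \<Rightarrow> ennreal" where
  "ennpowr a q = (if a = \<infinity> then \<infinity> else ennreal (enn2real a powr q))"

(* Taken in [0,\<infinity>], so that it is \<infinity> when f is not p-integrable on B
   (the Bochner integral would return 0 there). *)
definition mean_osc :: "'a::metric_space measure \<Rightarrow> real \<Rightarrow> ('a \<Rightarrow> real) \<Rightarrow> 'a set \<Rightarrow> ennreal" where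
  "mean_osc M p f B =
     ennpowr ((\<integral>\<^sup>+y\<in>B. ennreal (\<bar>f y - ball_avg M f B\<bar> powr p) \<partial>M) / emeasure M B) (1 / p)"

definition BMO_seminorm :: "'a::metric_space measure \<Rightarrow> real \<Rightarrow> ('a \<Rightarrow> real) \<Rightarrow> ennreal" where
  "BMO_seminorm M p f = (SUP x. SUP r\<in>{0<..}. mean_osc M p f (ball x r))"

(* The function spaces below are sets of functions, not of a.e. classes. All of them except
   C_u are closed under changing a measurable function on a null set. *)

definition BMOp :: "'a::metric_space measure \<Rightarrow> real \<Rightarrow> ('a \<Rightarrow> real) set" where
  "BMOp M p = {f \<in> L1_loc M. BMO_seminorm M p f < \<infinity>}"

abbreviation BMO :: "'a::metric_space measure \<Rightarrow> ('a \<Rightarrow> real) set" where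
  "BMO M \<equiv> BMOp M 1"

(* The supremum is over pairs of centre and prescribed radius: in a general metric space the
   set "ball x s" does not determine its radius. *)
definition VMOp :: "'a::metric_space measure \<Rightarrow> real \<Rightarrow> ('a \<Rightarrow> real) set" where
  "VMOp M p = {f \<in> BMOp M p.
     ((\<lambda>r. SUP x. SUP s\<in>{0<..r}. mean_osc M p f (ball x s)) \<longlongrightarrow> 0) (at_right 0)}"

definition C_u :: "('a::metric_space \<Rightarrow> real) set" where
  "C_u = {f. uniformly_continuous_on UNIV f}"

(* Closure in BMO M; the BMO seminorm vanishes on non-zero functions (constants), so this is
   the closure in a pseudometric space. *)
definition BMO_closure :: "'a::metric_space measure \<Rightarrow> ('a \<Rightarrow> real) set \<Rightarrow> ('a \<Rightarrow> real) set" where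
  "BMO_closure M S =
     {f \<in> BMO M. \<forall>\<epsilon>>0::real. \<exists>g\<in>S. BMO_seminorm M 1 (\<lambda>x. f x - g x) < ennreal \<epsilon>}"

end

theory Submission
  imports Defs "HOL-Real_Asymp.Real_Asymp"
begin

text \<open>
  A function in \<open>VMO\<^sup>p\<close> is approximated by its averages against the normalised tent kernel
  \<open>max 0 (1 - d(x,y)/r)\<close>. These are locally Lipschitz with constant controlled by the oscillation
  of \<open>f\<close> at scale \<open>2r\<close> divided by \<open>r\<close>, so the error has small oscillation on balls of radius below
  \<open>r\<close>; on larger balls a Vitali covering by balls of radius \<open>r\<close> bounds the \<open>L\<^sup>1\<close> norm of the error.

  Conversely, a function in the closure is the sum of a uniformly continuous function, whose
  oscillation vanishes uniformly at small scales, and a function of small \<open>BMO\<close> seminorm, so one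
  needs the \<open>BMO\<^sup>p\<close> seminorm to be bounded by the \<open>BMO\<close> seminorm. The John--Nirenberg argument is
  run for continuous functions only, which needs no Lebesgue differentiation, and passes to the
  closure by Fatou's lemma.
\<close>

section \<open>Covering by balls\<close>

text \<open>The two inclusions treat the exponents asymmetrically: from \<open>p\<close> down to 1
  an elementary pointwise inequality serves for every function, while from 1 up to \<open>p\<close>
  the moment bound is established on the closure. This is why the remainder \<open>f - g\<close>,
  which need not be continuous, has to be kept inside the closure. In the other inclusion the
  obstacle is that the oscillation of \<open>f\<close> is small on small balls and merely bounded on
  large ones, so on large balls the error cannot be estimated by the oscillations of its two terms
  and must be small in mean by itself. Averages over \<open>ball x r\<close> are the natural
  approximants, but they may jump with \<open>x\<close> when spheres carry mass; the tent is a
  Lipschitz replacement.\<close>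

text \<open>Zorn's lemma is applied to the disjoint subfamilies such that every ball meeting a member
  meets one of at least half its own radius.\<close>

lemma Vitali_covering_5r:
  fixes I :: "'a::metric_space set" and r :: "'a \<Rightarrow> real"
  assumes rad: "\<And>x. x \<in> I \<Longrightarrow> 0 < r x \<and> r x \<le> R"
  obtains J where "J \<subseteq> I" "disjoint_family_on (\<lambda>x. ball x (r x)) J"
    "(\<Union>x\<in>I. ball x (r x)) \<subseteq> (\<Union>x\<in>J. ball x (5 * r x))"
proof -
  let ?B = "\<lambda>x. ball x (r x)"
  define good where "good = (\<lambda>J. \<forall>x\<in>I. (\<exists>z\<in>J. ?B x \<inter> ?B z \<noteq> {}) \<longrightarrow>
    (\<exists>z\<in>J. ?B x \<inter> ?B z \<noteq> {} \<and> r x \<le> 2 * r z))"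
  define \<A> where "\<A> = {J. J \<subseteq> I \<and> disjoint_family_on ?B J \<and> good J}"
  have "\<Union>\<C> \<in> \<A>" if "subset.chain \<A> \<C>" for \<C>
  proof -
    have sub: "\<C> \<subseteq> \<A>" and ch: "\<And>X Y. X \<in> \<C> \<Longrightarrow> Y \<in> \<C> \<Longrightarrow> X \<subseteq> Y \<or> Y \<subseteq> X"
      using that by (auto simp: subset_chain_def)
    have "disjoint_family_on ?B (\<Union>\<C>)"
      unfolding disjoint_family_on_def
    proof (intro ballI impI)
      fix m n assume "m \<in> \<Union>\<C>" "n \<in> \<Union>\<C>" and mn: "m \<noteq> n"
      then obtain X where "X \<in> \<C>" "m \<in> X" "n \<in> X"
        using ch by blast
      then show "?B m \<inter> ?B n = {}"
        using sub mn by (auto simp: \<A>_def disjoint_family_on_def)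
    qed
    moreover have "good (\<Union>\<C>)"
      unfolding good_def
    proof (intro ballI impI)
      fix x assume "x \<in> I" "\<exists>z\<in>\<Union>\<C>. ?B x \<inter> ?B z \<noteq> {}"
      then obtain X where "X \<in> \<C>" "\<exists>z\<in>X. ?B x \<inter> ?B z \<noteq> {}"
        by blast
      moreover have "good X"
        using \<open>X \<in> \<C>\<close> sub by (auto simp: \<A>_def)
      ultimately have "\<exists>z\<in>X. ?B x \<inter> ?B z \<noteq> {} \<and> r x \<le> 2 * r z"
        using \<open>x \<in> I\<close> by (auto simp: good_def)
      then show "\<exists>z\<in>\<Union>\<C>. ?B x \<inter> ?B z \<noteq> {} \<and> r x \<le> 2 * r z"
        using \<open>X \<in> \<C>\<close> by blast
    qed
    ultimately show ?thesis
      using sub by (auto simp: \<A>_def)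
  qed
  then obtain J where J: "J \<in> \<A>" and maxJ: "\<And>X. X \<in> \<A> \<Longrightarrow> J \<subseteq> X \<Longrightarrow> X = J"
    using subset_Zorn' [of \<A>] by blast
  have JI: "J \<subseteq> I" and Jd: "disjoint_family_on ?B J" and Jg: "good J"
    using J by (auto simp: \<A>_def)
  \<comment> \<open>\<open>N\<close> collects the balls that miss every member of \<open>J\<close>.
    Adding one whose radius exceeds half the supremum over \<open>N\<close> keeps
    \<open>good\<close>: a ball of \<open>N\<close> that meets it has less than twice its radius,
    and a ball outside \<open>N\<close> already meets a suitable member of \<open>J\<close>.
    Maximality then forces \<open>N\<close> to be empty.\<close>
  define N where "N = {x \<in> I. \<forall>z\<in>J. ?B x \<inter> ?B z = {}}"
  have "N = {}"
  proof (rule ccontr)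
    assume ne: "N \<noteq> {}"
    \<comment> \<open>The uniform bound \<open>R\<close> makes the supremum over \<open>N\<close>
      finite.\<close>
    have bdd: "bdd_above (r ` N)"
      using rad by (auto simp: N_def bdd_above_def)
    obtain x0 where "x0 \<in> N"
      using ne by blast
    define S where "S = Sup (r ` N)"
    have "r x0 \<le> S"
      unfolding S_def using bdd \<open>x0 \<in> N\<close> by (auto intro: cSup_upper)
    moreover have "0 < r x0"
      using rad \<open>x0 \<in> N\<close> by (auto simp: N_def)
    ultimately have "S / 2 < S"
      by simp
    then obtain w where w: "w \<in> N" "S / 2 < r w"
      unfolding S_def using less_cSup_iff[OF _ bdd] ne by blast
    have wI: "w \<in> I" and wd: "\<And>z. z \<in> J \<Longrightarrow> ?B w \<inter> ?B z = {}"
      using w by (auto simp: N_def)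
    have "w \<in> ?B w"
      using rad wI by simp
    have "disjoint_family_on ?B (insert w J)"
      using Jd wd unfolding disjoint_family_on_def by blast
    moreover have "good (insert w J)"
      unfolding good_def
    proof (intro ballI impI)
      fix x assume x: "x \<in> I" and "\<exists>z\<in>insert w J. ?B x \<inter> ?B z \<noteq> {}"
      show "\<exists>z\<in>insert w J. ?B x \<inter> ?B z \<noteq> {} \<and> r x \<le> 2 * r z"
      proof (cases "x \<in> N")
        case True
        then have "r x \<le> S"
          unfolding S_def using bdd by (auto intro: cSup_upper)
        moreover have "?B x \<inter> ?B w \<noteq> {}"
          using True \<open>\<exists>z\<in>insert w J. _\<close> by (auto simp: N_def)
        ultimately show ?thesis
          using w by (intro bexI[of _ w]) auto
      next
        case False
        then show ?thesis
          using Jg x unfolding good_def N_def by blast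
      qed
    qed
    ultimately have "insert w J \<in> \<A>"
      using JI wI by (auto simp: \<A>_def)
    then have "w \<in> J"
      using maxJ by blast
    then show False
      using wd[of w] \<open>w \<in> ?B w\<close> by blast
  qed
  have "?B x \<subseteq> (\<Union>z\<in>J. ball z (5 * r z))" if x: "x \<in> I" for x
  proof -
    have "\<exists>z\<in>J. ?B x \<inter> ?B z \<noteq> {}"
      using \<open>N = {}\<close> x unfolding N_def by blast
    then obtain z y where z: "z \<in> J" "r x \<le> 2 * r z" and y: "dist x y < r x" "dist z y < r z"
      using Jg x unfolding good_def by (meson disjoint_iff mem_ball)
    \<comment> \<open>The factor is 1 + 4: reaching the common point \<open>y\<close> from
      \<open>z\<close> costs \<open>r z\<close>, and going on to \<open>t\<close> costs less than
      \<open>2 * r x \<le> 4 * r z\<close>.\<close>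
    have "?B x \<subseteq> ball z (5 * r z)"
    proof
      fix t assume "t \<in> ?B x"
      then have "dist x t < r x"
        by simp
      moreover have "dist z t \<le> dist z y + dist x y + dist x t"
        by metric
      ultimately show "t \<in> ball z (5 * r z)"
        using y z by simp
    qed
    then show ?thesis
      using z by blast
  qed
  then show thesis
    using that JI Jd by blast
qed

text \<open>A family obtained from Zorn's lemma comes without an enumeration. The finite partial
  sums of its measures are bounded by the measure of \<open>U\<close>, so the measures form a
  summable family, whose support is countable; positivity makes the support all of
  \<open>J\<close>.\<close>

lemma countable_disjoint_positive_measure:
  assumes "disjoint_family_on B J" "\<And>i. i \<in> J \<Longrightarrow> B i \<in> sets M"
    "\<And>i. i \<in> J \<Longrightarrow> B i \<subseteq> U" "\<And>i. i \<in> J \<Longrightarrow> 0 < measure M (B i)"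
    "U \<in> sets M" "emeasure M U < top"
  shows "countable J"
proof -
  have fin: "B i \<in> fmeasurable M" if "i \<in> J" for i
    using assms that fmeasurableI2[of U M "B i"] by (auto simp: fmeasurable_def)
  have "(\<Sum>i\<in>F. measure M (B i)) \<le> measure M U" if F: "F \<subseteq> J" "finite F" for F
  proof -
    have "(\<Sum>i\<in>F. measure M (B i)) = measure M (\<Union>i\<in>F. B i)"
      using F fin disjoint_family_on_mono[OF F(1) assms(1)] by (intro measure_UNION'[symmetric])
        (auto simp: disjoint_family_on_def pairwise_def disjnt_def)
    also have "\<dots> \<le> measure M U"
    proof (rule measure_mono_fmeasurable)
      show "(\<Union>i\<in>F. B i) \<subseteq> U"
        using F assms(3) by blast
    qed (use F assms in \<open>auto simp: fmeasurable_def\<close>)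
    finally show ?thesis .
  qed
  then have "(\<lambda>i. measure M (B i)) summable_on J"
    by (intro nonneg_bdd_above_summable_on) (auto simp: bdd_above_def)
  moreover have "{i \<in> J. measure M (B i) \<noteq> 0} = J"
    using assms(4) by force
  ultimately show ?thesis
    using summable_countable_real[of "\<lambda>i. measure M (B i)" J] by simp
qed

text \<open>Each point of \<open>E\<close> lies in at least one \<open>A i\<close>, so the
  indicators sum to at least 1 on \<open>E\<close>; then sum and integral are exchanged. Integrating
  against \<open>count_space J\<close> sums over \<open>J\<close> without choosing an
  enumeration.\<close>

lemma nn_integral_countable_cover:
  fixes u :: "'a \<Rightarrow> ennreal"
  assumes "countable J" "\<And>i. i \<in> J \<Longrightarrow> A i \<in> sets M" "E \<subseteq> (\<Union>i\<in>J. A i)" "E \<in> sets M"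
    and u: "u \<in> borel_measurable M"
  shows "(\<integral>\<^sup>+y\<in>E. u y \<partial>M) \<le> (\<integral>\<^sup>+i. (\<integral>\<^sup>+y\<in>E \<inter> A i. u y \<partial>M) \<partial>count_space J)"
proof -
  have "(\<integral>\<^sup>+y\<in>E. u y \<partial>M) \<le> (\<integral>\<^sup>+y. (\<integral>\<^sup>+i. u y * indicator (E \<inter> A i) y \<partial>count_space J) \<partial>M)"
  proof (rule nn_integral_mono)
    fix y
    show "u y * indicator E y \<le> (\<integral>\<^sup>+i. u y * indicator (E \<inter> A i) y \<partial>count_space J)"
    proof (cases "y \<in> E")
      case True
      then obtain i where "i \<in> J" "y \<in> A i"
        using assms by blast
      then show ?thesis
        using True nn_integral_ge_point[of i J "\<lambda>i. u y * indicator (E \<inter> A i) y"] by simp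
    qed simp
  qed
  also have "\<dots> = (\<integral>\<^sup>+i. (\<integral>\<^sup>+y\<in>E \<inter> A i. u y \<partial>M) \<partial>count_space J)"
    using assms by (intro nn_integral_count_space_nn_integral) auto
  finally show ?thesis .
qed

text \<open>The counterpart of the covering bound: by disjointness at most one summand is nonzero at
  each point.\<close>

lemma nn_integral_disjoint_le:
  fixes v :: "'a \<Rightarrow> ennreal"
  assumes "countable J" "disjoint_family_on B J" "\<And>i. i \<in> J \<Longrightarrow> B i \<in> sets M"
    "\<And>i. i \<in> J \<Longrightarrow> B i \<subseteq> U" and v: "v \<in> borel_measurable M"
  shows "(\<integral>\<^sup>+i. (\<integral>\<^sup>+y\<in>B i. v y \<partial>M) \<partial>count_space J) \<le> (\<integral>\<^sup>+y\<in>U. v y \<partial>M)"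
proof -
  have "(\<integral>\<^sup>+i. (\<integral>\<^sup>+y\<in>B i. v y \<partial>M) \<partial>count_space J)
      = (\<integral>\<^sup>+y. (\<integral>\<^sup>+i. v y * indicator (B i) y \<partial>count_space J) \<partial>M)"
    using assms by (intro nn_integral_count_space_nn_integral[symmetric]) auto
  also have "\<dots> \<le> (\<integral>\<^sup>+y\<in>U. v y \<partial>M)"
  proof (rule nn_integral_mono)
    fix y
    show "(\<integral>\<^sup>+i. v y * indicator (B i) y \<partial>count_space J) \<le> v y * indicator U y"
    proof (cases "\<exists>i\<in>J. y \<in> B i")
      case True
      then obtain i where i: "i \<in> J" "y \<in> B i"
        by blast
      then have "y \<notin> B j" if "j \<in> J" "j \<noteq> i" for j
        using assms(2) that by (auto simp: disjoint_family_on_def)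
      then have "(\<integral>\<^sup>+j. v y * indicator (B j) y \<partial>count_space J)
          = (\<integral>\<^sup>+j. v y * indicator (B j) y \<partial>count_space {i})"
        using i by (intro nn_integral_count_space_eq) auto
      also have "\<dots> = v y"
        using i by (simp add: nn_integral_count_space_finite)
      finally show ?thesis
        using i assms(4) by (auto simp: indicator_def)
    next
      case False
      then have "(\<integral>\<^sup>+i. v y * indicator (B i) y \<partial>count_space J) = (\<integral>\<^sup>+i. 0 \<partial>count_space J)"
        by (intro nn_integral_cong) auto
      then show ?thesis
        by simp
    qed
  qed
  finally show ?thesis .
qed

context metric_measure_space
begin

lemma sets_ball [measurable, simp]: "ball x r \<in> sets M"
  by (simp add: sets_eq_borel)

lemma emeasure_ball_less_top [simp]: "emeasure M (ball x r) < top"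
  using emeasure_ball_finite by (cases "0 < r") (auto simp: ball_empty)

lemma emeasure_ball: "emeasure M (ball x r) = ennreal (measure M (ball x r))"
  using emeasure_ball_less_top[of x r] by (simp add: emeasure_eq_ennreal_measure less_top)

lemma measure_ball_pos: "0 < r \<Longrightarrow> 0 < measure M (ball x r)"
  using emeasure_ball_pos[of r x] by (simp add: emeasure_ball)

lemma ball_fmeasurable [simp]: "ball x r \<in> fmeasurable M"
  using emeasure_ball_less_top by (auto simp: fmeasurable_def)

lemma measure_ball_mono: "ball x r \<subseteq> ball z s \<Longrightarrow> measure M (ball x r) \<le> measure M (ball z s)"
  by (intro measure_mono_fmeasurable) auto

text \<open>Summing over the disjoint balls of a Vitali subfamily turns a comparison of integrals on
  single balls into a global one.\<close>

lemma covering_nn_integral_le: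
  fixes u v :: "'a \<Rightarrow> ennreal"
  assumes rad: "\<And>x. x \<in> I \<Longrightarrow> 0 < r x \<and> r x \<le> R"
    and BU: "\<And>x. x \<in> I \<Longrightarrow> ball x (r x) \<subseteq> ball z s"
    and E: "E \<subseteq> (\<Union>x\<in>I. ball x (r x))" "E \<in> sets M"
    and u: "u \<in> borel_measurable M" and v: "v \<in> borel_measurable M"
    and le: "\<And>x. x \<in> I \<Longrightarrow>
      (\<integral>\<^sup>+y\<in>E \<inter> ball x (5 * r x). u y \<partial>M) \<le> (\<integral>\<^sup>+y\<in>ball x (r x). v y \<partial>M)"
  shows "(\<integral>\<^sup>+y\<in>E. u y \<partial>M) \<le> (\<integral>\<^sup>+y\<in>ball z s. v y \<partial>M)"
proof -
  obtain J where J: "J \<subseteq> I" "disjoint_family_on (\<lambda>x. ball x (r x)) J"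
    "(\<Union>x\<in>I. ball x (r x)) \<subseteq> (\<Union>x\<in>J. ball x (5 * r x))"
    using Vitali_covering_5r[of I r R] rad by metis
  have cJ: "countable J"
    by (rule countable_disjoint_positive_measure[OF J(2), of M "ball z s"])
      (use J(1) BU rad measure_ball_pos in auto)
  have "(\<integral>\<^sup>+y\<in>E. u y \<partial>M) \<le> (\<integral>\<^sup>+x. (\<integral>\<^sup>+y\<in>E \<inter> ball x (5 * r x). u y \<partial>M) \<partial>count_space J)"
    using cJ J(3) E u by (intro nn_integral_countable_cover) auto
  also have "\<dots> \<le> (\<integral>\<^sup>+x. (\<integral>\<^sup>+y\<in>ball x (r x). v y \<partial>M) \<partial>count_space J)"
    by (rule nn_integral_mono) (use le J(1) in auto)
  also have "\<dots> \<le> (\<integral>\<^sup>+y\<in>ball z s. v y \<partial>M)"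
    using cJ J BU v by (intro nn_integral_disjoint_le) auto
  finally show ?thesis .
qed

end

section \<open>Mean oscillation\<close>

lemma ennpowr_le_iff:
  assumes "0 \<le> t" "0 < p"
  shows "ennpowr a (1 / p) \<le> ennreal t \<longleftrightarrow> a \<le> ennreal (t powr p)"
proof (cases a)
  case (real b)
  have "b powr (1 / p) \<le> t \<longleftrightarrow> b \<le> t powr p"
    using real assms powr_mono2[of p "b powr (1 / p)" t] powr_mono2[of "1 / p" b "t powr p"]
    by (auto simp: powr_powr)
  then show ?thesis
    using real assms by (simp add: ennpowr_def)
next
  case top
  then show ?thesis
    by (simp add: ennpowr_def top_unique)
qed

lemma ennreal_divide_le_iff:
  fixes a c :: ennreal
  assumes "0 < m"
  shows "a / ennreal m \<le> c \<longleftrightarrow> a \<le> c * ennreal m"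
proof (cases a; cases c)
  fix x y assume "a = ennreal x" "0 \<le> x" "c = ennreal y" "0 \<le> y"
  then show ?thesis
    using assms by (simp add: divide_ennreal pos_divide_le_eq flip: ennreal_mult)
qed (use assms in \<open>auto simp: ennreal_top_divide ennreal_top_mult ennreal_mult_top top_unique ennreal_mult_eq_top_iff divide_ennreal simp flip: ennreal_mult\<close>)

lemma powr_scale_le:
  fixes p t s :: real
  assumes "1 \<le> p" "0 \<le> t" "0 \<le> s" "s \<le> 1"
  shows "(s * t) powr p \<le> s * t powr p"
proof -
  have "s powr p \<le> s"
    using powr_mono'[of 1 p s] assms by simp
  then show ?thesis
    using assms by (simp add: powr_mult mult_right_mono)
qed

context metric_measure_space
begin

lemma emeasure_ball_neq_top [simp]: "emeasure M (ball x r) \<noteq> top"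
  using emeasure_ball_less_top[of x r] by (simp add: less_top)

lemma L1_locD:
  assumes "f \<in> L1_loc M"
  shows "set_integrable M (ball x r) f"
  using assms by (cases "0 < r") (auto simp: L1_loc_def ball_empty)

text \<open>Integrability on balls gives measurability of truncations; \<open>f\<close> is their
  pointwise limit along the balls of radius \<open>k\<close> about a fixed centre, which exhaust the
  space.\<close>

lemma L1_loc_borel_measurable:
  assumes "f \<in> L1_loc M"
  shows "f \<in> borel_measurable M"
proof (rule borel_measurable_LIMSEQ_real)
  fix y :: 'a
  let ?x = "undefined :: 'a"
  obtain n :: nat where n: "dist ?x y < real n"
    using reals_Archimedean2 by blast
  have "eventually (\<lambda>k. indicator (ball ?x (real k)) y * f y = f y) sequentially"
    using eventually_ge_at_top[of n] by eventually_elim (use n in \<open>auto simp: indicator_def\<close>)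
  then show "(\<lambda>k. indicator (ball ?x (real k)) y * f y) \<longlonglongrightarrow> f y"
    by (rule tendsto_eventually)
next
  show "(\<lambda>y. indicator (ball (undefined :: 'a) (real k)) y * f y) \<in> borel_measurable M" for k
    using L1_locD[OF assms, of undefined "real k"] by (auto simp: set_integrable_def)
qed

lemma L1_loc_const [simp]: "(\<lambda>_. c) \<in> L1_loc M"
  unfolding L1_loc_def set_integrable_def by simp

lemma L1_loc_diff [simp]:
  "f \<in> L1_loc M \<Longrightarrow> g \<in> L1_loc M \<Longrightarrow> (\<lambda>x. f x - g x) \<in> L1_loc M"
  unfolding L1_loc_def by auto

lemma L1_loc_add [simp]:
  "f \<in> L1_loc M \<Longrightarrow> g \<in> L1_loc M \<Longrightarrow> (\<lambda>x. f x + g x) \<in> L1_loc M"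
  unfolding L1_loc_def by auto

lemma L1_loc_abs [simp]: "f \<in> L1_loc M \<Longrightarrow> (\<lambda>x. \<bar>f x\<bar>) \<in> L1_loc M"
  unfolding L1_loc_def by (auto intro: set_integrable_abs)

lemma L1_loc_mult_left [simp]: "f \<in> L1_loc M \<Longrightarrow> (\<lambda>x. c * f x) \<in> L1_loc M"
  unfolding L1_loc_def by auto

lemma set_integral_const_ball: "(LINT y:ball x r|M. c) = c * measure M (ball x r)"
  using set_integral_const[of "ball x r" M c] by (simp add: mult.commute)

lemma nn_integral_ball:
  assumes "f \<in> L1_loc M" "\<And>y. 0 \<le> f y"
  shows "(\<integral>\<^sup>+y\<in>ball x r. ennreal (f y) \<partial>M) = ennreal (LINT y:ball x r|M. f y)"
proof -
  have "(\<integral>\<^sup>+y\<in>ball x r. ennreal (f y) \<partial>M) = (\<integral>\<^sup>+y. ennreal (indicator (ball x r) y *\<^sub>R f y) \<partial>M)"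
    by (intro nn_integral_cong) (auto simp: indicator_def)
  also have "\<dots> = ennreal (LINT y:ball x r|M. f y)"
    unfolding set_lebesgue_integral_def using L1_locD[OF assms(1), of x r] assms(2)
    by (intro nn_integral_eq_integral) (auto simp: set_integrable_def)
  finally show ?thesis .
qed

lemma set_integral_mono_ball:
  assumes "f \<in> L1_loc M" "\<And>y. 0 \<le> f y" "ball x r \<subseteq> ball z s"
  shows "(LINT y:ball x r|M. f y) \<le> (LINT y:ball z s|M. f y)"
  unfolding set_lebesgue_integral_def
  using L1_locD[OF assms(1), of x r] L1_locD[OF assms(1), of z s] assms(2,3)
  by (intro integral_mono) (auto simp: set_integrable_def indicator_def)

lemma ball_avg_diff:
  assumes "f \<in> L1_loc M" "g \<in> L1_loc M"
  shows "ball_avg M (\<lambda>y. f y - g y) (ball x r) = ball_avg M f (ball x r) - ball_avg M g (ball x r)"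
  using set_integral_diff(2)[OF L1_locD L1_locD, OF assms, of x r]
  by (simp add: ball_avg_def diff_divide_distrib)

lemma abs_set_integral_le:
  assumes "f \<in> L1_loc M"
  shows "\<bar>LINT y:ball x r|M. f y\<bar> \<le> (LINT y:ball x r|M. \<bar>f y\<bar>)"
  unfolding set_lebesgue_integral_def
  using integral_abs_bound[of M "\<lambda>y. indicator (ball x r) y *\<^sub>R f y"] by (simp add: abs_mult)

text \<open>The workhorse for comparing averages: the integral of \<open>f - c\<close> over the
  small ball is dominated by that of its absolute value over any larger ball. The measure stays on
  the left so that doubling can be applied before dividing.\<close>

lemma ball_avg_approx:
  assumes f: "f \<in> L1_loc M" and "0 < r" and sub: "ball x r \<subseteq> ball z s"
  shows "\<bar>ball_avg M f (ball x r) - c\<bar> * measure M (ball x r) \<le> (LINT y:ball z s|M. \<bar>f y - c\<bar>)"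
proof -
  let ?m = "measure M (ball x r)"
  have "0 < ?m"
    using measure_ball_pos \<open>0 < r\<close> by simp
  have "(LINT y:ball x r|M. f y - c) = (ball_avg M f (ball x r) - c) * ?m"
    using \<open>0 < ?m\<close> set_integral_diff(2)[OF L1_locD L1_locD, OF f L1_loc_const, of x r c]
    by (simp add: set_integral_const_ball ball_avg_def algebra_simps)
  then have "\<bar>ball_avg M f (ball x r) - c\<bar> * ?m = \<bar>LINT y:ball x r|M. f y - c\<bar>"
    using \<open>0 < ?m\<close> by (simp add: abs_mult)
  also have "\<dots> \<le> (LINT y:ball x r|M. \<bar>f y - c\<bar>)"
    using f by (intro abs_set_integral_le) auto
  also have "\<dots> \<le> (LINT y:ball z s|M. \<bar>f y - c\<bar>)"
    using f sub by (intro set_integral_mono_ball) auto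
  finally show ?thesis .
qed

lemma set_integral_abs_diff_le:
  assumes f: "f \<in> L1_loc M"
  shows "(LINT y:ball x r|M. \<bar>f y - c\<bar>)
    \<le> (LINT y:ball x r|M. \<bar>f y - d\<bar>) + \<bar>d - c\<bar> * measure M (ball x r)"
proof -
  have "(LINT y:ball x r|M. \<bar>f y - c\<bar>) \<le> (LINT y:ball x r|M. \<bar>f y - d\<bar> + \<bar>d - c\<bar>)"
    using f by (intro set_integral_mono set_integral_add L1_locD) auto
  also have "\<dots> = (LINT y:ball x r|M. \<bar>f y - d\<bar>) + \<bar>d - c\<bar> * measure M (ball x r)"
    using f by (subst set_integral_add) (auto intro!: L1_locD simp: set_integral_const_ball)
  finally show ?thesis .
qed

text \<open>A bound on the mean oscillation with exponent 1, multiplied out over the reals. Working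
  with an explicit bound replaces suprema in \<open>ennreal\<close>;
  \<open>mean_osc_1_le_iff\<close> links the two.\<close>

definition osc_le :: "('a \<Rightarrow> real) \<Rightarrow> 'a \<Rightarrow> real \<Rightarrow> real \<Rightarrow> bool" where
  "osc_le f x r b \<longleftrightarrow>
    (LINT y:ball x r|M. \<bar>f y - ball_avg M f (ball x r)\<bar>) \<le> b * measure M (ball x r)"

text \<open>Any reference constant may replace the average at the cost of a factor 2, since the
  average differs from \<open>c\<close> by at most the mean of
  \<open>\<bar>f y - c\<bar>\<close>.\<close>

lemma osc_leI:
  assumes f: "f \<in> L1_loc M" and "0 < r"
    and le: "(LINT y:ball x r|M. \<bar>f y - c\<bar>) \<le> b * measure M (ball x r)"
  shows "osc_le f x r (2 * b)"
proof -
  have "\<bar>c - ball_avg M f (ball x r)\<bar> * measure M (ball x r) \<le> (LINT y:ball x r|M. \<bar>f y - c\<bar>)"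
    using ball_avg_approx[OF f \<open>0 < r\<close>, of x x r c] by (simp add: abs_minus_commute)
  then show ?thesis
    using set_integral_abs_diff_le[OF f, of x r "ball_avg M f (ball x r)" c] le
    by (simp add: osc_le_def)
qed

text \<open>Removing root and quotient leaves a comparison of nonnegative integrals, which stays
  meaningful when the \<open>p\<close>-th moment is infinite.\<close>

lemma mean_osc_le_iff:
  assumes "0 < r" "0 \<le> t" "0 < p"
  shows "mean_osc M p f (ball x r) \<le> ennreal t \<longleftrightarrow>
    (\<integral>\<^sup>+y\<in>ball x r. ennreal (\<bar>f y - ball_avg M f (ball x r)\<bar> powr p) \<partial>M)
      \<le> ennreal (t powr p * measure M (ball x r))"
  using assms measure_ball_pos[of r x]
  by (simp add: mean_osc_def ennpowr_le_iff emeasure_ball ennreal_divide_le_iff ennreal_mult)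

lemma mean_osc_1_le_iff:
  assumes "f \<in> L1_loc M" "0 < r" "0 \<le> b"
  shows "mean_osc M 1 f (ball x r) \<le> ennreal b \<longleftrightarrow> osc_le f x r b"
  using assms
  by (simp add: mean_osc_le_iff nn_integral_ball osc_le_def ennreal_le_iff)

lemma BMO_seminorm_le_iff:
  "BMO_seminorm M p f \<le> c \<longleftrightarrow> (\<forall>x r. 0 < r \<longrightarrow> mean_osc M p f (ball x r) \<le> c)"
  by (auto simp: BMO_seminorm_def SUP_le_iff)

lemma BMO_seminorm_1_le_iff:
  assumes "f \<in> L1_loc M" "0 \<le> b"
  shows "BMO_seminorm M 1 f \<le> ennreal b \<longleftrightarrow> (\<forall>x r. 0 < r \<longrightarrow> osc_le f x r b)"
  using assms by (simp add: BMO_seminorm_le_iff mean_osc_1_le_iff)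

lemma osc_le_mono: "osc_le f x r a \<Longrightarrow> a \<le> b \<Longrightarrow> osc_le f x r b"
  unfolding osc_le_def using mult_right_mono[of a b "measure M (ball x r)"] by simp

lemma osc_le_diff:
  assumes f: "f \<in> L1_loc M" and g: "g \<in> L1_loc M" and "osc_le f x r a" "osc_le g x r b"
  shows "osc_le (\<lambda>y. f y - g y) x r (a + b)"
proof -
  let ?af = "ball_avg M f (ball x r)" and ?ag = "ball_avg M g (ball x r)"
  have "(LINT y:ball x r|M. \<bar>f y - g y - (?af - ?ag)\<bar>)
      \<le> (LINT y:ball x r|M. \<bar>f y - ?af\<bar> + \<bar>g y - ?ag\<bar>)"
    using f g by (intro set_integral_mono set_integral_add L1_locD) auto
  also have "\<dots> = (LINT y:ball x r|M. \<bar>f y - ?af\<bar>) + (LINT y:ball x r|M. \<bar>g y - ?ag\<bar>)"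
    using f g by (intro set_integral_add L1_locD) auto
  also have "\<dots> \<le> (a + b) * measure M (ball x r)"
    using assms by (simp add: osc_le_def distrib_right)
  finally show ?thesis
    using f g by (simp add: osc_le_def ball_avg_diff)
qed

text \<open>The bound is taken strictly positive because the John--Nirenberg argument divides by it;
  a function of seminorm 0 gets the bound 1.\<close>

lemma BMO_iff:
  "f \<in> BMO M \<longleftrightarrow> f \<in> L1_loc M \<and> (\<exists>a>0. \<forall>x r. 0 < r \<longrightarrow> osc_le f x r a)"
proof
  assume f: "f \<in> BMO M"
  then have L: "f \<in> L1_loc M" and "BMO_seminorm M 1 f < top"
    by (auto simp: BMOp_def)
  then obtain b where b: "0 \<le> b" "BMO_seminorm M 1 f = ennreal b"
    by (cases "BMO_seminorm M 1 f") auto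
  then have "\<forall>x r. 0 < r \<longrightarrow> osc_le f x r b"
    using BMO_seminorm_1_le_iff[OF L b(1)] by simp
  then show "f \<in> L1_loc M \<and> (\<exists>a>0. \<forall>x r. 0 < r \<longrightarrow> osc_le f x r a)"
    using L b osc_le_mono[of f _ _ b "b + 1"] by (intro conjI exI[of _ "b + 1"]) auto
next
  assume "f \<in> L1_loc M \<and> (\<exists>a>0. \<forall>x r. 0 < r \<longrightarrow> osc_le f x r a)"
  then obtain a where "f \<in> L1_loc M" "0 < a" "\<forall>x r. 0 < r \<longrightarrow> osc_le f x r a"
    by blast
  then have "f \<in> L1_loc M" "BMO_seminorm M 1 f \<le> ennreal a"
    by (auto simp: BMO_seminorm_1_le_iff)
  then show "f \<in> BMO M"
    by (auto simp: BMOp_def intro: le_less_trans)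
qed

lemma BMO_diff:
  assumes "f \<in> BMO M" "g \<in> BMO M"
  shows "(\<lambda>y. f y - g y) \<in> BMO M"
proof -
  obtain a b where "f \<in> L1_loc M" "0 < a" "\<forall>x r. 0 < r \<longrightarrow> osc_le f x r a"
    "g \<in> L1_loc M" "0 < b" "\<forall>x r. 0 < r \<longrightarrow> osc_le g x r b"
    using assms unfolding BMO_iff by blast
  then show ?thesis
    unfolding BMO_iff by (intro conjI exI[of _ "a + b"]) (auto intro: osc_le_diff)
qed

lemma BMO_closure_iff:
  assumes "S \<subseteq> L1_loc M"
  shows "f \<in> BMO_closure M S \<longleftrightarrow>
    f \<in> BMO M \<and> (\<forall>e>0. \<exists>g\<in>S. \<forall>x r. 0 < r \<longrightarrow> osc_le (\<lambda>y. f y - g y) x r e)"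
proof (cases "f \<in> BMO M")
  case True
  then have f: "f \<in> L1_loc M"
    by (simp add: BMOp_def)
  have *: "BMO_seminorm M 1 (\<lambda>y. f y - g y) \<le> ennreal e
      \<longleftrightarrow> (\<forall>x r. 0 < r \<longrightarrow> osc_le (\<lambda>y. f y - g y) x r e)" if "g \<in> S" "0 < e" for g e
    using that f assms by (intro BMO_seminorm_1_le_iff) auto
  show ?thesis
  proof (intro iffI conjI allI impI)
    fix e :: real assume "f \<in> BMO_closure M S" "0 < e"
    then obtain g where "g \<in> S" "BMO_seminorm M 1 (\<lambda>y. f y - g y) < ennreal e"
      unfolding BMO_closure_def by blast
    then have "\<forall>x r. 0 < r \<longrightarrow> osc_le (\<lambda>y. f y - g y) x r e"
      using *[OF \<open>g \<in> S\<close> \<open>0 < e\<close>] less_imp_le by blast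
    then show "\<exists>g\<in>S. \<forall>x r. 0 < r \<longrightarrow> osc_le (\<lambda>y. f y - g y) x r e"
      using \<open>g \<in> S\<close> by blast
  next
    assume R: "f \<in> BMO M \<and> (\<forall>e>0. \<exists>g\<in>S. \<forall>x r. 0 < r \<longrightarrow> osc_le (\<lambda>y. f y - g y) x r e)"
    have "\<exists>g\<in>S. BMO_seminorm M 1 (\<lambda>y. f y - g y) < ennreal e" if "0 < e" for e
    proof -
      \<comment> \<open>Halving turns the non-strict bound of \<open>osc_le\<close> into the strict
        inequality in the definition of the closure.\<close>
      have "0 < e / 2"
        using that by simp
      then obtain g where "g \<in> S" "\<forall>x r. 0 < r \<longrightarrow> osc_le (\<lambda>y. f y - g y) x r (e / 2)"
        using R by blast
      then have "BMO_seminorm M 1 (\<lambda>y. f y - g y) \<le> ennreal (e / 2)"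
        using *[OF _ \<open>0 < e / 2\<close>] by simp
      moreover have "ennreal (e / 2) < ennreal e"
        using that by (simp add: ennreal_less_iff)
      ultimately show ?thesis
        using \<open>g \<in> S\<close> by (blast intro: le_less_trans)
    qed
    then show "f \<in> BMO_closure M S"
      using R by (simp add: BMO_closure_def)
  qed (rule True)
qed (simp add: BMO_closure_def)

lemma nn_integral_powr_le_liminf:
  assumes f: "f \<in> L1_loc M" and g: "\<And>n. g n \<in> L1_loc M" and "0 < p"
    and osc: "\<And>n. osc_le (\<lambda>y. f y - g n y) x r (e n)" and e: "e \<longlonglongrightarrow> 0"
    and le: "\<And>n::nat. (\<integral>\<^sup>+y\<in>ball x r. ennreal (\<bar>g n y - ball_avg M (g n) (ball x r)\<bar> powr p) \<partial>M) \<le> C"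
  shows "(\<integral>\<^sup>+y\<in>ball x r. ennreal (\<bar>f y - ball_avg M f (ball x r)\<bar> powr p) \<partial>M) \<le> C"
proof -
  let ?B = "ball x r"
  let ?af = "ball_avg M f ?B" and ?ag = "\<lambda>n. ball_avg M (g n) ?B"
  have [measurable]: "f \<in> borel_measurable M" "\<And>n. g n \<in> borel_measurable M"
    using f g L1_loc_borel_measurable by auto
  \<comment> \<open>Closeness in the seminorm leaves \<open>g n\<close> free to differ from
    \<open>f\<close> by a constant. Subtracting the difference of the averages removes this freedom
    and turns the oscillation bound into convergence of \<open>u n\<close> to 0 in
    \<open>L^1\<close>.\<close>
  define u where "u = (\<lambda>n y. indicator ?B y *\<^sub>R (f y - g n y - (?af - ?ag n)))"
  have int: "integrable M (u n)" for n
    using f g L1_locD[of "\<lambda>y. f y - g n y - (?af - ?ag n)" x r] by (simp add: u_def set_integrable_def)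
  have bound: "norm (\<integral>y. norm (u n y) \<partial>M) \<le> e n * measure M ?B" for n
    using osc[of n] f g
    by (simp add: u_def osc_le_def set_lebesgue_integral_def ball_avg_diff abs_mult)
  have "(\<lambda>n. e n * measure M ?B) \<longlonglongrightarrow> 0"
    using e by (rule tendsto_mult_left_zero)
  then have "(\<lambda>n. \<integral>y. norm (u n y) \<partial>M) \<longlonglongrightarrow> 0"
    by (rule Lim_null_comparison[OF always_eventually, OF allI, OF bound])
  then obtain s where "strict_mono s" and s: "AE y in M. (\<lambda>n. u (s n) y) \<longlonglongrightarrow> 0"
    using tendsto_L1_AE_subseq[of M u] int by blast
  let ?v = "\<lambda>n y. ennreal (\<bar>g n y - ?ag n\<bar> powr p) * indicator ?B y"
  have "AE y in M. ennreal (\<bar>f y - ?af\<bar> powr p) * indicator ?B y = liminf (\<lambda>n. ?v (s n) y)"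
    using s
  proof eventually_elim
    case (elim y)
    show ?case
    proof (cases "y \<in> ?B")
      case True
      have "(\<lambda>n. \<bar>(f y - ?af) - u (s n) y\<bar>) \<longlonglongrightarrow> \<bar>(f y - ?af) - 0\<bar>"
        by (intro tendsto_intros elim)
      moreover have "(\<lambda>n. \<bar>(f y - ?af) - u (s n) y\<bar>) = (\<lambda>n. \<bar>g (s n) y - ?ag (s n)\<bar>)"
        using True by (auto simp: u_def)
      ultimately have "(\<lambda>n. \<bar>g (s n) y - ?ag (s n)\<bar> powr p) \<longlonglongrightarrow> \<bar>f y - ?af\<bar> powr p"
        using \<open>0 < p\<close> by (intro tendsto_powr') auto
      then have "(\<lambda>n. ?v (s n) y) \<longlonglongrightarrow> ennreal (\<bar>f y - ?af\<bar> powr p)"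
        using True by (simp add: tendsto_ennrealI)
      then show ?thesis
        using True lim_imp_Liminf[of sequentially] by force
    qed (simp add: Liminf_const)
  qed
  then have "(\<integral>\<^sup>+y\<in>?B. ennreal (\<bar>f y - ?af\<bar> powr p) \<partial>M) = (\<integral>\<^sup>+y. liminf (\<lambda>n. ?v (s n) y) \<partial>M)"
    by (rule nn_integral_cong_AE)
  also have "\<dots> \<le> liminf (\<lambda>n. \<integral>\<^sup>+y. ?v (s n) y \<partial>M)"
    by (rule nn_integral_liminf) simp
  also have "\<dots> \<le> limsup (\<lambda>n. \<integral>\<^sup>+y. ?v (s n) y \<partial>M)"
    by (rule Liminf_le_Limsup) simp
  also have "\<dots> \<le> C"
    using le by (intro Limsup_bounded) auto
  finally show ?thesis .
qed

text \<open>A pointwise substitute for Hoelder's inequality: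
  \<open>b \<le> t + t powr (1 - p) * b powr p\<close>, trivially for \<open>b \<le> t\<close>, and
  otherwise because \<open>b powr (1 - p)\<close> is nonincreasing in \<open>b\<close>. Each of the
  two terms contributes \<open>t\<close> to the mean, whence the factor 2.\<close>

lemma osc_le_of_moment:
  assumes f: "f \<in> L1_loc M" and "0 < t" "1 \<le> p"
    and le: "(\<integral>\<^sup>+y\<in>ball x r. ennreal (\<bar>f y - ball_avg M f (ball x r)\<bar> powr p) \<partial>M)
      \<le> ennreal (t powr p * measure M (ball x r))"
  shows "osc_le f x r (2 * t)"
proof -
  let ?B = "ball x r"
  let ?u = "\<lambda>y. \<bar>f y - ball_avg M f ?B\<bar>"
  have [measurable]: "f \<in> borel_measurable M"
    using f L1_loc_borel_measurable by auto
  have pt: "b \<le> t + t powr (1 - p) * b powr p" if "0 \<le> b" for b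
  proof (cases "b \<le> t")
    case False
    then have "b = (b powr (1 - p)) * b powr p"
      using \<open>0 < t\<close> by (simp flip: powr_add)
    also have "\<dots> \<le> t powr (1 - p) * b powr p"
      using False assms by (intro mult_right_mono powr_mono2') auto
    finally show ?thesis
      using \<open>0 < t\<close> by simp
  qed (simp add: add_increasing2)
  have "ennreal (LINT y:?B|M. ?u y) = (\<integral>\<^sup>+y\<in>?B. ennreal (?u y) \<partial>M)"
    using f by (intro nn_integral_ball[symmetric]) auto
  also have "\<dots> \<le> (\<integral>\<^sup>+y. ennreal t * indicator ?B y
      + ennreal (t powr (1 - p)) * (ennreal (?u y powr p) * indicator ?B y) \<partial>M)"
    using pt \<open>0 < t\<close>
    by (intro nn_integral_mono) (auto simp: indicator_def simp flip: ennreal_mult ennreal_plus intro!: ennreal_leI)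
  also have "\<dots> = ennreal t * emeasure M ?B
      + ennreal (t powr (1 - p)) * (\<integral>\<^sup>+y\<in>?B. ennreal (?u y powr p) \<partial>M)"
    by (subst nn_integral_add) (auto simp: nn_integral_cmult)
  also have "\<dots> \<le> ennreal t * emeasure M ?B
      + ennreal (t powr (1 - p)) * ennreal (t powr p * measure M ?B)"
    by (intro add_left_mono mult_left_mono le) auto
  also have "\<dots> = ennreal (t * measure M ?B + t powr (1 - p) * (t powr p * measure M ?B))"
    using \<open>0 < t\<close> by (simp add: emeasure_ball ennreal_mult ennreal_plus)
  also have "t powr (1 - p) * (t powr p * measure M ?B) = t * measure M ?B"
    using \<open>0 < t\<close> by (simp flip: powr_add mult.assoc)
  finally show ?thesis
    using \<open>0 < t\<close> by (simp add: osc_le_def ennreal_le_iff)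
qed

text \<open>Meant for two kernels: a tent, with \<open>C = 1\<close>, and the difference of two
  tents, with \<open>C\<close> the distance of their centres divided by \<open>r\<close>.\<close>

lemma kernel_integral_bound:
  assumes [measurable]: "\<phi> \<in> borel_measurable M" and f: "f \<in> L1_loc M" and "0 \<le> C"
    and bd: "\<And>y. \<bar>\<phi> y\<bar> \<le> C * indicator (ball z s) y"
  shows "integrable M (\<lambda>y. \<phi> y * f y)"
    and "\<bar>\<integral>y. \<phi> y * f y \<partial>M\<bar> \<le> C * (LINT y:ball z s|M. \<bar>f y\<bar>)"
proof -
  have [measurable]: "f \<in> borel_measurable M"
    using f L1_loc_borel_measurable by auto
  have dom: "integrable M (\<lambda>y. C * (indicator (ball z s) y *\<^sub>R \<bar>f y\<bar>))"
    using L1_locD[OF L1_loc_abs[OF f], of z s] unfolding set_integrable_def by (rule integrable_mult_right)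
  have le: "\<bar>\<phi> y * f y\<bar> \<le> C * (indicator (ball z s) y *\<^sub>R \<bar>f y\<bar>)" for y
    using mult_right_mono[OF bd[of y], of "\<bar>f y\<bar>"] by (simp add: abs_mult mult.assoc)
  show i: "integrable M (\<lambda>y. \<phi> y * f y)"
    by (rule Bochner_Integration.integrable_bound[OF dom]) (use le in \<open>auto intro: order_trans[OF _ abs_ge_self]\<close>)
  have "\<bar>\<integral>y. \<phi> y * f y \<partial>M\<bar> \<le> (\<integral>y. \<bar>\<phi> y * f y\<bar> \<partial>M)"
    by (rule integral_abs_bound)
  also have "\<dots> \<le> (\<integral>y. C * (indicator (ball z s) y *\<^sub>R \<bar>f y\<bar>) \<partial>M)"
    by (intro integral_mono dom integrable_abs i le)
  finally show "\<bar>\<integral>y. \<phi> y * f y \<partial>M\<bar> \<le> C * (LINT y:ball z s|M. \<bar>f y\<bar>)"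
    by (simp add: set_lebesgue_integral_def)
qed

end

section \<open>The John--Nirenberg inequality\<close>

lemma summable_powr_half_power:
  fixes p :: real
  shows "summable (\<lambda>k. (real k + 1) powr p * (1 / 2) ^ k)"
proof (rule summable_comparison_test_bigo)
  \<comment> \<open>Any ratio strictly between 1/2 and 1 absorbs the polynomial factor.\<close>
  show "summable (\<lambda>k. norm ((3 / 4 :: real) ^ k))"
    by simp
  show "(\<lambda>k. (real k + 1) powr p * (1 / 2) ^ k) \<in> O(\<lambda>k. (3 / 4) ^ k)"
    by real_asymp
qed

text \<open>Fixing the doubling constant under the name \<open>D\<close>, for real-valued measures,
  lets later constants be explicit: each doubling of a radius contributes one factor
  \<open>D\<close>, and exponents are rounded up to merge terms.\<close>

locale doubling_const = metric_measure_space +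
  fixes D :: real
  assumes D_ge_1: "1 \<le> D"
    and doubling_D: "0 < r \<Longrightarrow> measure M (ball x (2 * r)) \<le> D * measure M (ball x r)"
begin

lemma doubling_4:
  assumes "0 < r"
  shows "measure M (ball x (4 * r)) \<le> D ^ 2 * measure M (ball x r)"
proof -
  have "measure M (ball x (4 * r)) \<le> D * measure M (ball x (2 * r))"
    using doubling_D[of "2 * r" x] assms by simp
  also have "\<dots> \<le> D * (D * measure M (ball x r))"
    using doubling_D[OF assms, of x] D_ge_1 by (intro mult_left_mono) auto
  finally show ?thesis
    by (simp add: power2_eq_square)
qed

lemma doubling_8:
  assumes "0 < r"
  shows "measure M (ball x (8 * r)) \<le> D ^ 3 * measure M (ball x r)"
proof -
  have "measure M (ball x (8 * r)) \<le> D ^ 2 * measure M (ball x (2 * r))"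
    using doubling_4[of "2 * r" x] assms by simp
  also have "\<dots> \<le> D ^ 2 * (D * measure M (ball x r))"
    using doubling_D[OF assms, of x] D_ge_1 by (intro mult_left_mono) auto
  finally show ?thesis
    by (simp add: power2_eq_square power3_eq_cube)
qed

text \<open>Meant for \<open>s = 5 * r\<close>, the dilation of the Vitali covering; 8 is the least
  power of 2 above 5.\<close>

lemma doubling_8_le:
  assumes "0 < r" "s \<le> 8 * r"
  shows "measure M (ball x s) \<le> D ^ 3 * measure M (ball x r)"
  using doubling_8[OF assms(1), of x] measure_ball_mono[OF subset_ball[OF assms(2)], of x] by linarith

text \<open>The stopping balls may leave the ball \<^term>\<open>ball x R\<close>, which does no harm because the induction
  hypothesis covers all balls. Continuity replaces the Lebesgue differentiation theorem.\<close>

lemma John_Nirenberg_continuous: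
  assumes f: "f \<in> L1_loc M" "continuous_on UNIV f"
    and a: "0 < a" and osc: "\<And>x r. 0 < r \<Longrightarrow> osc_le f x r a" and "0 < R"
  shows "measure M {y \<in> ball x R. real k * (4 * D ^ 5 * a) < \<bar>f y - ball_avg M f (ball x R)\<bar>}
    \<le> (1 / 2) ^ k * measure M (ball x R)"
  using \<open>0 < R\<close>
proof (induction k arbitrary: x R)
  case 0
  have [measurable]: "f \<in> borel_measurable M"
    using f L1_loc_borel_measurable by auto
  have "{y \<in> ball x R. real 0 * (4 * D ^ 5 * a) < \<bar>f y - ball_avg M f (ball x R)\<bar>} \<in> sets M"
    by measurable
  then show ?case
    by (auto intro!: measure_mono_fmeasurable)
next
  case (Suc k)
  have fm [measurable]: "f \<in> borel_measurable M"
    using f L1_loc_borel_measurable by auto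
  \<comment> \<open>The step height is calibrated by the last line of the proof: dilating the
    stopping balls costs \<open>D ^ 3\<close>, the integral over the doubled ball costs
    \<open>2 * D ^ 2 * a\<close>, and dividing the product by \<open>4 * D ^ 5 * a\<close> leaves
    the factor 1/2 gained in each step. It also dominates the deviation at the top scale, see
    \<open>base\<close>.\<close>
  define l where "l = 4 * D ^ 5 * a"
  have "0 < l"
    using a D_ge_1 by (simp add: l_def)
  have pw: "D ^ m \<le> D ^ n" if "m \<le> n" for m n
    using that D_ge_1 by (intro power_increasing) auto
  have pw1: "1 \<le> D ^ n" for n
    using D_ge_1 by simp
  let ?m = "\<lambda>x r. measure M (ball x r)"
  let ?av = "\<lambda>x r. ball_avg M f (ball x r)"
  define c where "c = ?av x R"
  have m0: "0 < ?m x R"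
    using measure_ball_pos Suc.prems by simp
  have m2: "?m x (2 * R) \<le> D * ?m x R"
    using doubling_D Suc.prems by simp
  have osc2: "(LINT y:ball x (2 * R)|M. \<bar>f y - ?av x (2 * R)\<bar>) \<le> a * ?m x (2 * R)"
    using osc[of "2 * R" x] Suc.prems by (simp add: osc_le_def)
  have "\<bar>c - ?av x (2 * R)\<bar> * ?m x R \<le> a * ?m x (2 * R)"
    unfolding c_def using ball_avg_approx[OF f(1), of R x x "2 * R" "?av x (2 * R)"] osc2 Suc.prems
    by (auto intro: order_trans simp: subset_ball)
  also have "\<dots> \<le> a * (D * ?m x R)"
    using m2 a by simp
  finally have c2: "\<bar>c - ?av x (2 * R)\<bar> \<le> a * D"
    using m0 by (simp flip: mult.assoc)
  \<comment> \<open>The stopping balls are centred in \<open>ball x R\<close> and have radius at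
    most \<open>R / 5\<close>, so they lie in the doubled ball. The integral is therefore needed
    there, although \<open>c\<close> is the average over \<open>ball x R\<close>.\<close>
  have int2: "(LINT y:ball x (2 * R)|M. \<bar>f y - c\<bar>) \<le> 2 * D ^ 2 * a * ?m x R"
  proof -
    have "(LINT y:ball x (2 * R)|M. \<bar>f y - c\<bar>)
        \<le> a * ?m x (2 * R) + \<bar>?av x (2 * R) - c\<bar> * ?m x (2 * R)"
      using set_integral_abs_diff_le[OF f(1), of x "2 * R" c "?av x (2 * R)"] osc2 by simp
    also have "\<dots> \<le> a * (D * ?m x R) + a * D * (D * ?m x R)"
      using c2 m2 a m0 D_ge_1 by (intro add_mono mult_mono) (auto simp: abs_minus_commute)
    also have "a * (D * ?m x R) \<le> a * D * (D * ?m x R)"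
      using a m0 D_ge_1 by simp
    finally show ?thesis
      by (simp add: power2_eq_square algebra_simps)
  qed
  \<comment> \<open>At the top radius \<open>R\<close> the average about a point of
    \<open>ball x R\<close> deviates from \<open>c\<close> by at most \<open>l\<close>, so the
    selection below never stops at index 0 and the selected scale has a predecessor.\<close>
  have base: "\<bar>?av y R - c\<bar> \<le> l" if "y \<in> ball x R" for y
  proof -
    have sub: "ball y R \<subseteq> ball x (2 * R)"
    proof
      fix t assume "t \<in> ball y R"
      then show "t \<in> ball x (2 * R)"
        using that dist_triangle[of x t y] by simp
    qed
    have "ball x R \<subseteq> ball y (4 * R)"
    proof
      fix t assume "t \<in> ball x R"
      then show "t \<in> ball y (4 * R)"
        using that dist_triangle[of y t x] Suc.prems by (simp add: dist_commute)
    qed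
    then have mxy: "?m x R \<le> D ^ 2 * ?m y R"
      using measure_ball_mono doubling_4[OF Suc.prems, of y] by (meson order_trans)
    have "\<bar>?av y R - c\<bar> * ?m y R \<le> 2 * D ^ 2 * a * ?m x R"
      using ball_avg_approx[OF f(1) Suc.prems sub, of c] int2 by simp
    also have "\<dots> \<le> 2 * D ^ 2 * a * (D ^ 2 * ?m y R)"
      using mxy a by (intro mult_left_mono) auto
    finally have "\<bar>?av y R - c\<bar> * ?m y R \<le> (2 * D ^ 4 * a) * ?m y R"
      by (simp add: power_add[of D 2 2, simplified] mult_ac)
    then have "\<bar>?av y R - c\<bar> \<le> 2 * D ^ 4 * a"
      using measure_ball_pos[OF Suc.prems, of y] by simp
    also have "\<dots> \<le> 4 * D ^ 5 * a"
      using pw[of 4 5] pw1[of 5] a by (intro mult_right_mono) auto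
    finally show ?thesis
      by (simp add: l_def)
  qed
  define E where "E = {y \<in> ball x R. real (Suc k) * l < \<bar>f y - c\<bar>}"
  have Esets: "E \<in> sets M"
    unfolding E_def by measurable
  \<comment> \<open>Stopping rule: among the radii \<open>R / 5 ^ j\<close>, take the largest at
    which the average about \<open>y\<close> deviates from \<open>c\<close> by more than
    \<open>l\<close>; averages at small scales approach \<open>f y\<close>, so there is one. The
    ratio 5 matches the dilation of the covering: the dilated ball is the predecessor, where the
    deviation is still at most \<open>l\<close>.\<close>
  have "\<exists>\<rho>>0. 5 * \<rho> \<le> R \<and> l < \<bar>?av y \<rho> - c\<bar> \<and> \<bar>?av y (5 * \<rho>) - c\<bar> \<le> l" if y: "y \<in> E" for y
  proof -
    have yx: "y \<in> ball x R"
      using y by (simp add: E_def)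
    have "l \<le> real (Suc k) * l"
      using \<open>0 < l\<close> by simp
    then have "l < \<bar>f y - c\<bar>"
      using y by (simp add: E_def)
    define e where "e = (\<bar>f y - c\<bar> - l) / 2"
    have "0 < e"
      using \<open>l < \<bar>f y - c\<bar>\<close> by (simp add: e_def)
    then obtain d where "0 < d" and d: "\<And>t. dist t y < d \<Longrightarrow> dist (f t) (f y) < e"
      using f(2) unfolding continuous_on_iff by (metis UNIV_I)
    obtain j where j: "(1 / 5) ^ j < d / R"
      using real_arch_pow_inv[of "d / R" "1 / 5"] \<open>0 < d\<close> Suc.prems by auto
    let ?r = "\<lambda>j. R / 5 ^ j"
    have rpos: "0 < ?r j" for j
      using Suc.prems by simp
    have "?r j < d"
      using j Suc.prems by (simp add: field_simps)
    have "\<bar>?av y (?r j) - f y\<bar> * ?m y (?r j) \<le> (LINT t:ball y (?r j)|M. \<bar>f t - f y\<bar>)"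
      using rpos f by (intro ball_avg_approx) auto
    also have "\<dots> \<le> (LINT t:ball y (?r j)|M. e)"
    proof (rule set_integral_mono)
      fix t assume "t \<in> ball y (?r j)"
      then show "\<bar>f t - f y\<bar> \<le> e"
        using d[of t] \<open>?r j < d\<close> by (simp add: dist_real_def dist_commute)
    qed (use f in \<open>auto intro!: L1_locD\<close>)
    also have "\<dots> = e * ?m y (?r j)"
      by (rule set_integral_const_ball)
    finally have "\<bar>?av y (?r j) - f y\<bar> \<le> e"
      using measure_ball_pos[OF rpos] by simp
    then have ex: "l < \<bar>?av y (?r j) - c\<bar>"
      using \<open>l < \<bar>f y - c\<bar>\<close> unfolding e_def by argo
    define i where "i = (LEAST j. l < \<bar>?av y (?r j) - c\<bar>)"
    have i: "l < \<bar>?av y (?r i) - c\<bar>"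
      unfolding i_def using ex by (rule LeastI)
    have "i \<noteq> 0"
      using i base[OF yx] by (intro notI) simp
    then obtain i' where i': "i = Suc i'"
      using not0_implies_Suc by blast
    have "\<not> l < \<bar>?av y (?r i') - c\<bar>"
      using not_less_Least[of i' "\<lambda>j. l < \<bar>?av y (?r j) - c\<bar>"] i' by (simp add: i_def)
    moreover have "5 * ?r i = ?r i'"
      by (simp add: i')
    moreover have "?r i' \<le> R"
      using Suc.prems by (simp add: field_simps)
    ultimately show ?thesis
      using i rpos by (intro exI[of _ "?r i"]) auto
  qed
  then obtain \<rho> where \<rho>: "\<And>y. y \<in> E \<Longrightarrow> 0 < \<rho> y" "\<And>y. y \<in> E \<Longrightarrow> 5 * \<rho> y \<le> R"
    "\<And>y. y \<in> E \<Longrightarrow> l < \<bar>?av y (\<rho> y) - c\<bar>" "\<And>y. y \<in> E \<Longrightarrow> \<bar>?av y (5 * \<rho> y) - c\<bar> \<le> l"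
    by metis
  define K where "K = (1 / 2) ^ k * D ^ 3 / l"
  have "0 \<le> K"
    using \<open>0 < l\<close> D_ge_1 by (simp add: K_def)
  have "(\<integral>\<^sup>+y\<in>E. 1 \<partial>M) \<le> (\<integral>\<^sup>+y\<in>ball x (2 * R). ennreal (K * \<bar>f y - c\<bar>) \<partial>M)"
  proof (rule covering_nn_integral_le[where I = E and r = \<rho> and R = R])
    fix y assume y: "y \<in> E"
    show "0 < \<rho> y \<and> \<rho> y \<le> R"
      using \<rho>(1,2)[OF y] by linarith
    show "ball y (\<rho> y) \<subseteq> ball x (2 * R)"
    proof
      fix t assume "t \<in> ball y (\<rho> y)"
      then show "t \<in> ball x (2 * R)"
        using y \<rho>(1,2)[OF y] dist_triangle[of x t y] by (simp add: E_def)
    qed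
    let ?F = "{t \<in> ball y (5 * \<rho> y). real k * l < \<bar>f t - ?av y (5 * \<rho> y)\<bar>}"
    \<comment> \<open>A deviation above \<open>(k + 1) * l\<close> from \<open>c\<close> forces one
      above \<open>k * l\<close> from the average over the dilated ball, since the two reference
      values differ by at most \<open>l\<close>. This opens the way to the induction hypothesis on
      that ball.\<close>
    have "E \<inter> ball y (5 * \<rho> y) \<subseteq> ?F"
      using \<rho>(4)[OF y] by (auto simp: E_def algebra_simps)
    then have "measure M (E \<inter> ball y (5 * \<rho> y)) \<le> measure M ?F"
    proof (rule measure_mono_fmeasurable)
      have "?F \<in> sets M"
        by measurable
      then show "?F \<in> fmeasurable M"
        by (rule fmeasurableI2[OF ball_fmeasurable, rotated]) auto
    qed (use Esets in auto)
    also have "\<dots> \<le> (1 / 2) ^ k * ?m y (5 * \<rho> y)"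
      using Suc.IH[of "5 * \<rho> y" y] \<rho>(1)[OF y] by (simp add: l_def)
    also have "\<dots> \<le> (1 / 2) ^ k * (D ^ 3 * ?m y (\<rho> y))"
      using doubling_8_le[of "\<rho> y" "5 * \<rho> y" y] \<rho>(1)[OF y] by (intro mult_left_mono) auto
    also have "\<dots> = K * (l * ?m y (\<rho> y))"
      using \<open>0 < l\<close> by (simp add: K_def)
    \<comment> \<open>The stopping inequality trades the measure of the small ball for the integral
      of \<open>\<bar>f t - c\<bar>\<close> over it, and these integrals can be summed over disjoint
      balls.\<close>
    also have "\<dots> \<le> K * (\<bar>?av y (\<rho> y) - c\<bar> * ?m y (\<rho> y))"
      using \<open>0 \<le> K\<close> \<rho>(3)[OF y] by (intro mult_left_mono mult_right_mono) auto
    also have "\<dots> \<le> K * (LINT t:ball y (\<rho> y)|M. \<bar>f t - c\<bar>)"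
      using \<open>0 \<le> K\<close> \<rho>(1)[OF y] f by (intro mult_left_mono ball_avg_approx) auto
    finally have "ennreal (measure M (E \<inter> ball y (5 * \<rho> y))) \<le> ennreal (LINT t:ball y (\<rho> y)|M. K * \<bar>f t - c\<bar>)"
      by (simp add: ennreal_leI)
    moreover have "emeasure M (E \<inter> ball y (5 * \<rho> y)) < top"
      using emeasure_mono[of "E \<inter> ball y (5 * \<rho> y)" "ball y (5 * \<rho> y)" M]
      by (auto intro: le_less_trans)
    ultimately show "(\<integral>\<^sup>+t\<in>E \<inter> ball y (5 * \<rho> y). 1 \<partial>M)
        \<le> (\<integral>\<^sup>+t\<in>ball y (\<rho> y). ennreal (K * \<bar>f t - c\<bar>) \<partial>M)"
      using Esets f \<open>0 \<le> K\<close> by (simp add: nn_integral_ball emeasure_eq_ennreal_measure)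
  next
    show "E \<subseteq> (\<Union>y\<in>E. ball y (\<rho> y))"
      using \<rho>(1) by force
  qed (use Esets in auto)
  also have "\<dots> = ennreal (K * (LINT y:ball x (2 * R)|M. \<bar>f y - c\<bar>))"
    using f \<open>0 \<le> K\<close> by (subst nn_integral_ball) auto
  finally have "emeasure M E \<le> ennreal (K * (LINT y:ball x (2 * R)|M. \<bar>f y - c\<bar>))"
    using Esets by simp
  then have "measure M E \<le> K * (LINT y:ball x (2 * R)|M. \<bar>f y - c\<bar>)"
    unfolding measure_def using \<open>0 \<le> K\<close>
    by (intro enn2real_leI) (auto intro!: mult_nonneg_nonneg simp: set_lebesgue_integral_def)
  also have "\<dots> \<le> K * (2 * D ^ 2 * a * ?m x R)"
    using int2 \<open>0 \<le> K\<close> by (rule mult_left_mono)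
  also have "\<dots> = (1 / 2) ^ Suc k * ?m x R"
    using a D_ge_1 by (simp add: K_def l_def power_add[of D 3 2, simplified])
  finally show ?case
    by (simp add: E_def l_def c_def)
qed

text \<open>A discrete layer-cake argument with steps of height \<open>l\<close>: a point whose
  deviation lies above \<open>k * l\<close> and not above \<open>(k + 1) * l\<close> belongs to
  \<open>S k\<close>, so the moment is at most the sum of \<open>((k + 1) * l) powr p\<close> times
  the measure of \<open>S k\<close>, and the geometric decay of these measures makes the series
  converge.\<close>

lemma John_Nirenberg_moment:
  assumes "1 \<le> p"
  obtains K where "1 \<le> K"
    "\<And>f a x R. f \<in> L1_loc M \<Longrightarrow> continuous_on UNIV f \<Longrightarrow> 0 < a \<Longrightarrow>
      (\<And>x r. 0 < r \<Longrightarrow> osc_le f x r a) \<Longrightarrow> 0 < R \<Longrightarrow>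
      (\<integral>\<^sup>+y\<in>ball x R. ennreal (\<bar>f y - ball_avg M f (ball x R)\<bar> powr p) \<partial>M)
        \<le> ennreal (K * a powr p * measure M (ball x R))"
proof -
  let ?c = "\<lambda>k. (real k + 1) powr p * (1 / 2) ^ k"
  define \<Sigma> where "\<Sigma> = suminf ?c"
  have sums: "?c sums \<Sigma>"
    unfolding \<Sigma>_def using summable_powr_half_power by (rule summable_sums)
  have "0 \<le> \<Sigma>"
    unfolding \<Sigma>_def by (intro suminf_nonneg summable_powr_half_power) auto
  \<comment> \<open>The maximum with 1 lets later arguments divide by \<open>K\<close> and use
    \<open>1 / (2 * K) \<le> 1\<close>.\<close>
  define K where "K = max 1 ((4 * D ^ 5) powr p * \<Sigma>)"
  show thesis
  proof (rule that[of K])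
    show "1 \<le> K"
      by (simp add: K_def)
    fix f and a :: real and x :: 'a and R :: real
    assume f: "f \<in> L1_loc M" "continuous_on UNIV f" and a: "0 < a"
      and osc: "\<And>x r. 0 < r \<Longrightarrow> osc_le f x r a" and "0 < R"
    let ?B = "ball x R"
    let ?u = "\<lambda>y. \<bar>f y - ball_avg M f ?B\<bar>"
    define l where "l = 4 * D ^ 5 * a"
    have "0 < l"
      using a D_ge_1 by (simp add: l_def)
    define S where "S = (\<lambda>k. {y \<in> ?B. real k * l < ?u y})"
    have [measurable]: "f \<in> borel_measurable M"
      using f L1_loc_borel_measurable by auto
    have Ss [measurable]: "S k \<in> sets M" for k
      unfolding S_def by measurable
    have Sfin: "emeasure M (S k) = ennreal (measure M (S k))" for k
    proof -
      have "emeasure M (S k) \<le> emeasure M ?B"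
        by (intro emeasure_mono) (auto simp: S_def)
      then show ?thesis
        by (intro emeasure_eq_ennreal_measure) (auto simp: top_unique)
    qed
    have "(\<integral>\<^sup>+y\<in>?B. ennreal (?u y powr p) \<partial>M)
        \<le> (\<integral>\<^sup>+y. (\<Sum>k. ennreal (((real k + 1) * l) powr p) * indicator (S k) y) \<partial>M)"
    proof (rule nn_integral_mono)
      fix y
      show "ennreal (?u y powr p) * indicator ?B y
          \<le> (\<Sum>k. ennreal (((real k + 1) * l) powr p) * indicator (S k) y)"
      \<comment> \<open>Where the deviation vanishes so does its power, while even
        \<open>S 0\<close> asks for a strictly positive deviation; such points are separated because
        no index \<open>k\<close> belongs to them.\<close>
      proof (cases "y \<in> ?B \<and> ?u y \<noteq> 0")
        case True
        obtain n :: nat where "?u y < real n * l"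
          using reals_Archimedean3[OF \<open>0 < l\<close>] by blast
        then have ex: "?u y \<le> real n * l"
          by simp
        define m where "m = (LEAST n. ?u y \<le> real n * l)"
        have m: "?u y \<le> real m * l"
          unfolding m_def using ex by (rule LeastI)
        then have "m \<noteq> 0"
          using True by (intro notI) simp
        then obtain k where k: "m = Suc k"
          using not0_implies_Suc by blast
        then have "\<not> ?u y \<le> real k * l"
          using not_less_Least[of k "\<lambda>n. ?u y \<le> real n * l"] by (simp add: m_def)
        then have yS: "y \<in> S k"
          using True by (simp add: S_def)
        have "ennreal (?u y powr p) \<le> ennreal (((real k + 1) * l) powr p)"
          using m k assms by (intro ennreal_leI powr_mono2) (auto simp: add.commute)
        then have "ennreal (?u y powr p) * indicator ?B y
            \<le> (\<Sum>k\<in>{k}. ennreal (((real k + 1) * l) powr p) * indicator (S k) y)"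
          using yS by (simp add: indicator_def)
        also have "\<dots> \<le> (\<Sum>k. ennreal (((real k + 1) * l) powr p) * indicator (S k) y)"
          by (intro sum_le_suminf) auto
        finally show ?thesis .
      qed auto
    qed
    also have "\<dots> = (\<Sum>k. ennreal (((real k + 1) * l) powr p) * emeasure M (S k))"
      by (subst nn_integral_suminf) (auto simp: nn_integral_cmult_indicator)
    also have "\<dots> \<le> (\<Sum>k. ennreal (l powr p * measure M ?B * ?c k))"
    proof (intro suminf_le allI)
      fix k
      have "((real k + 1) * l) powr p * measure M (S k)
          \<le> ((real k + 1) * l) powr p * ((1 / 2) ^ k * measure M ?B)"
        using John_Nirenberg_continuous[OF f a osc \<open>0 < R\<close>, of x k]
        by (intro mult_left_mono) (auto simp: S_def l_def)
      then show "ennreal (((real k + 1) * l) powr p) * emeasure M (S k)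
          \<le> ennreal (l powr p * measure M ?B * ?c k)"
        using \<open>0 < l\<close> by (simp add: Sfin powr_mult mult_ac flip: ennreal_mult)
    qed auto
    also have "\<dots> = ennreal (l powr p * measure M ?B * \<Sigma>)"
      using sums by (intro suminf_ennreal_eq sums_mult) auto
    also have "\<dots> \<le> ennreal (K * a powr p * measure M ?B)"
    proof (rule ennreal_leI)
      have "l powr p * measure M ?B * \<Sigma> = ((4 * D ^ 5) powr p * \<Sigma>) * (a powr p * measure M ?B)"
        using a D_ge_1 by (simp add: l_def powr_mult)
      also have "\<dots> \<le> K * (a powr p * measure M ?B)"
        by (intro mult_right_mono) (auto simp: K_def)
      finally show "l powr p * measure M ?B * \<Sigma> \<le> K * a powr p * measure M ?B"
        by (simp add: mult.assoc)
    qed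
    finally show "(\<integral>\<^sup>+y\<in>?B. ennreal (?u y powr p) \<partial>M) \<le> ennreal (K * a powr p * measure M ?B)" .
  qed
qed

section \<open>The closure is contained in VMO^p\<close>

lemma C_u_BMO_diff:
  assumes "f \<in> C_u \<inter> BMO M" "g \<in> C_u \<inter> BMO M"
  shows "(\<lambda>y. f y - g y) \<in> C_u \<inter> BMO M"
  using assms BMO_diff by (auto simp: C_u_def intro: uniformly_continuous_on_diff)

lemma C_u_BMO_L1_loc: "C_u \<inter> BMO M \<subseteq> L1_loc M"
  by (auto simp: BMOp_def)

text \<open>The moment bound is wanted for the small remainder \<open>f - g\<close>. It is again a
  limit of admissible functions: if \<open>h\<close> approximates \<open>f\<close>, then
  \<open>h - g\<close> approximates \<open>f - g\<close> with the same error.\<close>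

lemma BMO_closure_diff:
  assumes f: "f \<in> BMO_closure M (C_u \<inter> BMO M)" and g: "g \<in> C_u \<inter> BMO M"
  shows "(\<lambda>y. f y - g y) \<in> BMO_closure M (C_u \<inter> BMO M)"
  unfolding BMO_closure_iff[OF C_u_BMO_L1_loc]
proof (intro conjI allI impI)
  show "(\<lambda>y. f y - g y) \<in> BMO M"
    using f g by (intro BMO_diff) (auto simp: BMO_closure_def)
  fix e :: real assume "0 < e"
  then obtain h where h: "h \<in> C_u \<inter> BMO M" "\<forall>x r. 0 < r \<longrightarrow> osc_le (\<lambda>y. f y - h y) x r e"
    using f unfolding BMO_closure_iff[OF C_u_BMO_L1_loc] by blast
  have "(\<lambda>y. f y - g y - (h y - g y)) = (\<lambda>y. f y - h y)"
    by auto
  then show "\<exists>h\<in>C_u \<inter> BMO M. \<forall>x r. 0 < r \<longrightarrow> osc_le (\<lambda>y. f y - g y - h y) x r e"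
    using h C_u_BMO_diff[OF h(1) g] by (intro bexI[of _ "\<lambda>y. h y - g y"]) auto
qed

text \<open>Fatou's lemma along an almost everywhere convergent subsequence of approximants extends
  the John--Nirenberg bound from continuous functions to the closure.\<close>

lemma closure_moment:
  assumes "1 \<le> p"
  obtains K where "1 \<le> K"
    "\<And>f a x R. f \<in> BMO_closure M (C_u \<inter> BMO M) \<Longrightarrow> 0 < a \<Longrightarrow>
      (\<And>x r. 0 < r \<Longrightarrow> osc_le f x r a) \<Longrightarrow> 0 < R \<Longrightarrow>
      (\<integral>\<^sup>+y\<in>ball x R. ennreal (\<bar>f y - ball_avg M f (ball x R)\<bar> powr p) \<partial>M)
        \<le> ennreal (K * (2 * a) powr p * measure M (ball x R))"
proof -
  obtain K where "1 \<le> K" and K: "\<And>f a x R. f \<in> L1_loc M \<Longrightarrow> continuous_on UNIV f \<Longrightarrow> 0 < a \<Longrightarrow>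
      (\<And>x r. 0 < r \<Longrightarrow> osc_le f x r a) \<Longrightarrow> 0 < R \<Longrightarrow>
      (\<integral>\<^sup>+y\<in>ball x R. ennreal (\<bar>f y - ball_avg M f (ball x R)\<bar> powr p) \<partial>M)
        \<le> ennreal (K * a powr p * measure M (ball x R))"
    using John_Nirenberg_moment[OF assms] by blast
  show thesis
  proof (rule that[OF \<open>1 \<le> K\<close>])
    fix f and a :: real and x :: 'a and R :: real
    assume f: "f \<in> BMO_closure M (C_u \<inter> BMO M)" and a: "0 < a"
      and osc: "\<And>x r. 0 < r \<Longrightarrow> osc_le f x r a" and "0 < R"
    \<comment> \<open>The tolerances tend to 0, as the limit argument requires, and never exceed
      \<open>a\<close>, so the approximants have oscillation at most \<open>2 * a\<close>. This is
      the 2 in the conclusion.\<close>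
    define e where "e = (\<lambda>n. a / real (Suc n))"
    have e: "0 < e n" "e n \<le> a" for n
      using a by (auto simp: e_def field_simps)
    have "\<exists>h. h \<in> C_u \<inter> BMO M \<and> (\<forall>x r. 0 < r \<longrightarrow> osc_le (\<lambda>y. f y - h y) x r (e n))" for n
      using f e(1)[of n] unfolding BMO_closure_iff[OF C_u_BMO_L1_loc] by blast
    then obtain g where g: "\<And>n. g n \<in> C_u \<inter> BMO M"
      "\<And>n x r. 0 < r \<Longrightarrow> osc_le (\<lambda>y. f y - g n y) x r (e n)"
      by metis
    have fL: "f \<in> L1_loc M" and gL: "\<And>n. g n \<in> L1_loc M"
      using f g(1) by (auto simp: BMO_closure_def BMOp_def)
    have og: "osc_le (g n) x r (2 * a)" if "0 < r" for n x r
    proof -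
      have "osc_le (\<lambda>y. f y - (f y - g n y)) x r (a + e n)"
        using that fL gL osc g(2) by (intro osc_le_diff) auto
      then show ?thesis
        using osc_le_mono[of _ x r "a + e n" "2 * a"] e(2)[of n] by simp
    qed
    show "(\<integral>\<^sup>+y\<in>ball x R. ennreal (\<bar>f y - ball_avg M f (ball x R)\<bar> powr p) \<partial>M)
        \<le> ennreal (K * (2 * a) powr p * measure M (ball x R))"
    proof (rule nn_integral_powr_le_liminf[OF fL gL])
      show "0 < p"
        using assms by simp
      show "osc_le (\<lambda>y. f y - g n y) x R (e n)" for n
        using g(2) \<open>0 < R\<close> by blast
      show "e \<longlonglongrightarrow> 0"
        unfolding e_def using lim_const_over_n[of a] by (rule LIMSEQ_Suc)
      have "continuous_on UNIV (g n)" for n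
        using g(1)[of n] by (auto simp: C_u_def uniformly_continuous_imp_continuous)
      then show "(\<integral>\<^sup>+y\<in>ball x R. ennreal (\<bar>g n y - ball_avg M (g n) (ball x R)\<bar> powr p) \<partial>M)
          \<le> ennreal (K * (2 * a) powr p * measure M (ball x R))" for n
        using K[OF gL, of n "2 * a" R x] og a \<open>0 < R\<close> by simp
    qed
  qed
qed

text \<open>Two points of a ball of radius \<open>s\<close> are at distance less than
  \<open>2 * s\<close>, hence the scale in \<open>near\<close>.\<close>

lemma ball_avg_close:
  assumes g: "g \<in> L1_loc M" and "0 < s"
    and near: "\<And>y z. dist y z < 2 * s \<Longrightarrow> \<bar>g y - g z\<bar> \<le> w"
    and y: "y \<in> ball x s"
  shows "\<bar>g y - ball_avg M g (ball x s)\<bar> \<le> w"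
proof -
  have "\<bar>ball_avg M g (ball x s) - g y\<bar> * measure M (ball x s) \<le> (LINT t:ball x s|M. \<bar>g t - g y\<bar>)"
    using g \<open>0 < s\<close> by (intro ball_avg_approx) auto
  also have "\<dots> \<le> (LINT t:ball x s|M. w)"
  proof (rule set_integral_mono)
    fix t assume "t \<in> ball x s"
    then have "dist t y < 2 * s"
      using y dist_triangle[of t y x] by (simp add: dist_commute)
    then show "\<bar>g t - g y\<bar> \<le> w"
      by (rule near)
  qed (use g in \<open>auto intro!: L1_locD\<close>)
  also have "\<dots> = w * measure M (ball x s)"
    by (rule set_integral_const_ball)
  finally show ?thesis
    using measure_ball_pos[OF \<open>0 < s\<close>, of x] by (simp add: abs_minus_commute)
qed

lemma closure_small_osc:
  assumes f: "f \<in> BMO_closure M (C_u \<inter> BMO M)" and p: "1 \<le> p" and "0 < t"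
  obtains d where "0 < d" "\<And>x s. 0 < s \<Longrightarrow> s < d \<Longrightarrow> mean_osc M p f (ball x s) \<le> ennreal t"
proof -
  obtain K where "1 \<le> K" and K: "\<And>f a x R. f \<in> BMO_closure M (C_u \<inter> BMO M) \<Longrightarrow> 0 < a \<Longrightarrow>
      (\<And>x r. 0 < r \<Longrightarrow> osc_le f x r a) \<Longrightarrow> 0 < R \<Longrightarrow>
      (\<integral>\<^sup>+y\<in>ball x R. ennreal (\<bar>f y - ball_avg M f (ball x R)\<bar> powr p) \<partial>M)
        \<le> ennreal (K * (2 * a) powr p * measure M (ball x R))"
    using closure_moment[OF p] by blast
  \<comment> \<open>The remainder contributes
    \<open>2 powr p * K * (2 * e) powr p = K * (t / (2 * K)) powr p\<close>, which is at most half
    of \<open>t powr p\<close> because \<open>1 / (2 * K) \<le> 1\<close> and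
    \<open>1 \<le> p\<close>.\<close>
  define e where "e = t / (8 * K)"
  have "0 < e"
    using \<open>0 < t\<close> \<open>1 \<le> K\<close> by (simp add: e_def)
  then obtain g where g: "g \<in> C_u \<inter> BMO M" "\<forall>x r. 0 < r \<longrightarrow> osc_le (\<lambda>y. f y - g y) x r e"
    using f unfolding BMO_closure_iff[OF C_u_BMO_L1_loc] by blast
  have fL: "f \<in> L1_loc M" and gL: "g \<in> L1_loc M"
    using f g(1) by (auto simp: BMO_closure_def BMOp_def)
  have [measurable]: "f \<in> borel_measurable M" "g \<in> borel_measurable M"
    using fL gL L1_loc_borel_measurable by auto
  have "uniformly_continuous_on UNIV g"
    using g(1) by (simp add: C_u_def)
  \<comment> \<open>Under the factor 2 of \<open>ptw\<close> the tolerance \<open>t / 4\<close>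
    becomes \<open>t / 2\<close>, whose \<open>p\<close>-th power is at most the other half of
    \<open>t powr p\<close>.\<close>
  then obtain d where "0 < d" and d: "\<And>y z. dist y z < d \<Longrightarrow> dist (g y) (g z) < t / 4"
    unfolding uniformly_continuous_on_def using \<open>0 < t\<close> by (metis UNIV_I zero_less_divide_iff zero_less_numeral)
  \<comment> \<open>A sum is at most twice the larger of its terms, and the power of a maximum is at
    most the sum of the powers.\<close>
  have ptw: "\<bar>u + v\<bar> powr p \<le> 2 powr p * \<bar>u\<bar> powr p + (2 * w) powr p" if "\<bar>v\<bar> \<le> w" for u v w :: real
  proof -
    have "\<bar>u + v\<bar> powr p \<le> (max (2 * \<bar>u\<bar>) (2 * w)) powr p"
      using that p by (intro powr_mono2) auto
    also have "\<dots> \<le> (2 * \<bar>u\<bar>) powr p + (2 * w) powr p"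
      by (simp add: max_def)
    finally show ?thesis
      by (simp add: powr_mult)
  qed
  show thesis
  proof (rule that[of "d / 2"])
    show "0 < d / 2"
      using \<open>0 < d\<close> by simp
    fix x :: 'a and s :: real assume s: "0 < s" "s < d / 2"
    let ?B = "ball x s" and ?h = "\<lambda>y. f y - g y"
    have "ennreal (\<bar>f y - ball_avg M f ?B\<bar> powr p) * indicator ?B y
        \<le> ennreal (2 powr p) * (ennreal (\<bar>?h y - ball_avg M ?h ?B\<bar> powr p) * indicator ?B y)
          + ennreal ((2 * (t / 4)) powr p) * indicator ?B y" for y
    proof (cases "y \<in> ?B")
      case True
      have "\<bar>g y - ball_avg M g ?B\<bar> \<le> t / 4"
      proof (rule ball_avg_close[OF gL s(1) _ True])
        fix a b :: 'a assume "dist a b < 2 * s"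
        then show "\<bar>g a - g b\<bar> \<le> t / 4"
          using d[of a b] s by (simp add: dist_real_def)
      qed
      then have "\<bar>(?h y - ball_avg M ?h ?B) + (g y - ball_avg M g ?B)\<bar> powr p
          \<le> 2 powr p * \<bar>?h y - ball_avg M ?h ?B\<bar> powr p + (2 * (t / 4)) powr p"
        by (rule ptw)
      then have "\<bar>f y - ball_avg M f ?B\<bar> powr p
          \<le> 2 powr p * \<bar>?h y - ball_avg M ?h ?B\<bar> powr p + (2 * (t / 4)) powr p"
        using fL gL by (simp add: ball_avg_diff)
      then have "ennreal (\<bar>f y - ball_avg M f ?B\<bar> powr p)
          \<le> ennreal (2 powr p * \<bar>?h y - ball_avg M ?h ?B\<bar> powr p + (2 * (t / 4)) powr p)"
        by (rule ennreal_leI)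
      then show ?thesis
        using True by (simp add: ennreal_mult)
    qed simp
    then have "(\<integral>\<^sup>+y\<in>?B. ennreal (\<bar>f y - ball_avg M f ?B\<bar> powr p) \<partial>M)
        \<le> (\<integral>\<^sup>+y. ennreal (2 powr p) * (ennreal (\<bar>?h y - ball_avg M ?h ?B\<bar> powr p) * indicator ?B y)
          + ennreal ((2 * (t / 4)) powr p) * indicator ?B y \<partial>M)"
      by (rule nn_integral_mono)
    also have "\<dots> = ennreal (2 powr p) * (\<integral>\<^sup>+y\<in>?B. ennreal (\<bar>?h y - ball_avg M ?h ?B\<bar> powr p) \<partial>M)
        + ennreal ((2 * (t / 4)) powr p) * emeasure M ?B"
      by (subst nn_integral_add) (auto simp: nn_integral_cmult)
    also have "\<dots> \<le> ennreal (2 powr p) * ennreal (K * (2 * e) powr p * measure M ?B)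
        + ennreal ((2 * (t / 4)) powr p) * emeasure M ?B"
      using g(2) \<open>0 < e\<close> s
      by (intro add_right_mono mult_left_mono K BMO_closure_diff[OF f g(1)]) auto
    also have "\<dots> = ennreal ((2 powr p * (K * (2 * e) powr p) + (2 * (t / 4)) powr p) * measure M ?B)"
      using \<open>1 \<le> K\<close> by (simp add: emeasure_ball distrib_right mult.assoc flip: ennreal_mult ennreal_plus)
    also have "\<dots> \<le> ennreal (t powr p * measure M ?B)"
    proof (intro ennreal_leI mult_right_mono)
      have "2 powr p * (K * (2 * e) powr p) = K * ((1 / (2 * K)) * t) powr p"
        using \<open>0 < t\<close> \<open>1 \<le> K\<close> by (simp add: e_def flip: powr_mult)
      also have "\<dots> \<le> K * (1 / (2 * K) * t powr p)"
        using \<open>0 < t\<close> \<open>1 \<le> K\<close> p by (intro mult_left_mono powr_scale_le) auto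
      also have "\<dots> = t powr p / 2"
        using \<open>1 \<le> K\<close> by simp
      finally show "2 powr p * (K * (2 * e) powr p) + (2 * (t / 4)) powr p \<le> t powr p"
        using powr_scale_le[OF p, of t "1 / 2"] \<open>0 < t\<close> by simp
    qed auto
    finally show "mean_osc M p f ?B \<le> ennreal t"
      using s \<open>0 < t\<close> p by (subst mean_osc_le_iff) auto
  qed
qed

lemma closure_subset_VMOp:
  assumes p: "1 \<le> p"
  shows "BMO_closure M (C_u \<inter> BMO M) \<subseteq> VMOp M p"
proof
  fix f assume f: "f \<in> BMO_closure M (C_u \<inter> BMO M)"
  then have "f \<in> BMO M"
    by (simp add: BMO_closure_def)
  then obtain a where fL: "f \<in> L1_loc M" and a: "0 < a" "\<And>x r. 0 < r \<Longrightarrow> osc_le f x r a"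
    unfolding BMO_iff by blast
  obtain K where "1 \<le> K" and K: "\<And>f a x R. f \<in> BMO_closure M (C_u \<inter> BMO M) \<Longrightarrow> 0 < a \<Longrightarrow>
      (\<And>x r. 0 < r \<Longrightarrow> osc_le f x r a) \<Longrightarrow> 0 < R \<Longrightarrow>
      (\<integral>\<^sup>+y\<in>ball x R. ennreal (\<bar>f y - ball_avg M f (ball x R)\<bar> powr p) \<partial>M)
        \<le> ennreal (K * (2 * a) powr p * measure M (ball x R))"
    using closure_moment[OF p] by blast
  \<comment> \<open>The \<open>p\<close>-th root of the moment bound, as
    \<open>mean_osc_le_iff\<close> expects.\<close>
  define t where "t = K powr (1 / p) * (2 * a)"
  have "t powr p = K * (2 * a) powr p"
    using \<open>1 \<le> K\<close> a p by (simp add: t_def powr_mult powr_powr)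
  moreover have "0 < t"
    using a \<open>1 \<le> K\<close> by (simp add: t_def)
  ultimately have "mean_osc M p f (ball x r) \<le> ennreal t" if "0 < r" for x r
    using that K[OF f a that] p by (subst mean_osc_le_iff) auto
  then have "BMO_seminorm M p f \<le> ennreal t"
    by (simp add: BMO_seminorm_le_iff)
  then have "f \<in> BMOp M p"
    using fL by (auto simp: BMOp_def intro: le_less_trans)
  moreover have "((\<lambda>r. SUP x. SUP s\<in>{0<..r}. mean_osc M p f (ball x s)) \<longlongrightarrow> 0) (at_right 0)"
  proof (rule order_tendstoI)
    fix c :: ennreal assume "0 < c"
    \<comment> \<open>\<open>c\<close> may be infinite; a level strictly between 0 and
      \<open>c\<close> is finite, and it also yields the strict inequality from a non-strict
      bound.\<close>
    then obtain t' where t': "0 < t'" "t' < c"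
      using dense by blast
    then have "t' < top"
      using top.not_eq_extremum by fastforce
    then obtain t where t: "t' = ennreal t" "0 \<le> t"
      by (cases t') auto
    then have "0 < t"
      using t'(1) by simp
    then obtain d where "0 < d" and d: "\<And>x s. 0 < s \<Longrightarrow> s < d \<Longrightarrow> mean_osc M p f (ball x s) \<le> ennreal t"
      using closure_small_osc[OF f p] by blast
    have "(SUP x. SUP s\<in>{0<..r}. mean_osc M p f (ball x s)) < c" if "r < d" for r
    proof -
      have "(SUP x. SUP s\<in>{0<..r}. mean_osc M p f (ball x s)) \<le> ennreal t"
        using d that by (intro SUP_least) auto
      then show ?thesis
        using t'(2) t by simp
    qed
    then show "\<forall>\<^sub>F r in at_right 0. (SUP x. SUP s\<in>{0<..r}. mean_osc M p f (ball x s)) < c"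
      using \<open>0 < d\<close> by (auto simp: eventually_at_right_field)
  qed auto
  ultimately show "f \<in> VMOp M p"
    by (simp add: VMOp_def)
qed

subsection \<open>Smoothing by a tent kernel\<close>

definition tent :: "real \<Rightarrow> 'a \<Rightarrow> 'a \<Rightarrow> real" where
  "tent r x y = max 0 (1 - dist x y / r)"

definition tent_mass :: "real \<Rightarrow> 'a \<Rightarrow> real" where
  "tent_mass r x = (\<integral>y. tent r x y \<partial>M)"

definition smoothing :: "real \<Rightarrow> ('a \<Rightarrow> real) \<Rightarrow> 'a \<Rightarrow> real" where
  "smoothing r f x = (\<integral>y. tent r x y * f y \<partial>M) / tent_mass r x"

lemma continuous_borel_measurable:
  fixes f :: "'a \<Rightarrow> real"
  assumes "continuous_on UNIV f"
  shows "f \<in> borel_measurable M"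
  using borel_measurable_continuous_onI[OF assms] measurable_cong_sets[OF sets_eq_borel refl] by blast

lemma tent_measurable [measurable]: "tent r x \<in> borel_measurable M"
  unfolding tent_def divide_inverse by (intro continuous_borel_measurable continuous_intros)

lemma tent_le_indicator:
  assumes "0 < r" "ball x r \<subseteq> ball z s"
  shows "\<bar>tent r x y\<bar> \<le> 1 * indicator (ball z s) y"
proof (cases "dist x y < r")
  case True
  then have "y \<in> ball z s"
    using assms(2) by auto
  then show ?thesis
    using assms(1) by (simp add: tent_def)
next
  case False
  then have "tent r x y = 0"
    using assms(1) by (simp add: tent_def)
  then show ?thesis
    by (simp add: indicator_def)
qed

lemma tent_diff_le_indicator:
  assumes "0 < r" "ball x r \<subseteq> ball z s" "ball x' r \<subseteq> ball z s"
  shows "\<bar>tent r x y - tent r x' y\<bar> \<le> dist x x' / r * indicator (ball z s) y"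
proof (cases "y \<in> ball z s")
  case True
  have "\<bar>tent r x y - tent r x' y\<bar> \<le> \<bar>dist x' y / r - dist x y / r\<bar>"
    unfolding tent_def by linarith
  also have "\<dots> = \<bar>dist x' y - dist x y\<bar> / r"
    using \<open>0 < r\<close> by (simp flip: diff_divide_distrib)
  also have "\<dots> \<le> dist x x' / r"
    using \<open>0 < r\<close> abs_dist_diff_le[of x' y x] by (intro divide_right_mono) (auto simp: dist_commute)
  finally show ?thesis
    using True by simp
next
  case False
  then have "tent r x y = 0" "tent r x' y = 0"
    using tent_le_indicator[OF assms(1,2), of y] tent_le_indicator[OF assms(1,3), of y] by auto
  then show ?thesis
    using False by simp
qed

lemma integrable_tent_mult:
  assumes "0 < r" "f \<in> L1_loc M"
  shows "integrable M (\<lambda>y. tent r x y * f y)"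
  using kernel_integral_bound(1)[OF tent_measurable assms(2), of 1 r x x r] tent_le_indicator assms(1)
  by simp

lemma integrable_tent: "0 < r \<Longrightarrow> integrable M (tent r x)"
  using integrable_tent_mult[of r "\<lambda>_. 1" x] by simp

text \<open>The tent is at least 1/2 on the ball of half the radius, and doubling recovers the full
  ball. The normalising mass is thus comparable to the measure of the ball.\<close>

lemma measure_ball_le_tent_mass:
  assumes "0 < r"
  shows "measure M (ball x r) \<le> 2 * D * tent_mass r x"
proof -
  have "(\<integral>y. 1 / 2 * indicator (ball x (r / 2)) y \<partial>M) \<le> tent_mass r x"
    unfolding tent_mass_def
  proof (rule integral_mono)
    show "integrable M (\<lambda>y. 1 / 2 * indicator (ball x (r / 2)) y :: real)"
      by simp
    show "1 / 2 * indicator (ball x (r / 2)) y \<le> tent r x y" for y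
      using assms by (auto simp: tent_def indicator_def field_simps max_def)
  qed (use assms in \<open>rule integrable_tent\<close>)
  then have "measure M (ball x (r / 2)) \<le> 2 * tent_mass r x"
    by simp
  then have "D * measure M (ball x (r / 2)) \<le> D * (2 * tent_mass r x)"
    using D_ge_1 by (intro mult_left_mono) auto
  then show ?thesis
    using doubling_D[of "r / 2" x] assms by simp
qed

lemma tent_mass_pos:
  assumes "0 < r"
  shows "0 < tent_mass r x"
proof -
  have "0 < (2 * D) * tent_mass r x"
    using measure_ball_le_tent_mass[OF assms, of x] measure_ball_pos[OF assms, of x] by linarith
  then show ?thesis
    using D_ge_1 by (simp add: zero_less_mult_iff)
qed

text \<open>Normalisation reproduces constants, so any constant can be subtracted under the kernel.
  This is how the oscillation of \<open>f\<close>, instead of its size, enters the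
  estimates.\<close>

lemma smoothing_minus_const:
  assumes "0 < r" "f \<in> L1_loc M"
  shows "smoothing r f x - c = (\<integral>y. tent r x y * (f y - c) \<partial>M) / tent_mass r x"
proof -
  have "(\<integral>y. tent r x y * (f y - c) \<partial>M) = (\<integral>y. tent r x y * f y - tent r x y * c \<partial>M)"
    by (simp add: right_diff_distrib)
  also have "\<dots> = (\<integral>y. tent r x y * f y \<partial>M) - tent_mass r x * c"
    using integrable_tent_mult[OF assms] integrable_tent[OF assms(1)]
    by (simp add: tent_mass_def)
  finally show ?thesis
    using tent_mass_pos[OF assms(1), of x] by (simp add: smoothing_def field_simps)
qed

text \<open>The reference average is taken over \<open>ball x (2 * r)\<close> although the kernel
  lives on \<open>ball x r\<close>: the larger ball also contains the kernels about nearby centres,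
  so the same hypothesis serves the Lipschitz bound. The price is one more factor
  \<open>D\<close>.\<close>

lemma smoothing_approx:
  assumes r: "0 < r" and f: "f \<in> L1_loc M" and osc: "osc_le f x (2 * r) b"
  shows "\<bar>smoothing r f x - ball_avg M f (ball x (2 * r))\<bar> \<le> 2 * D ^ 2 * b"
proof -
  let ?m = "measure M (ball x (2 * r))" and ?c = "ball_avg M f (ball x (2 * r))"
  let ?w = "tent_mass r x"
  have w: "0 < ?w"
    by (rule tent_mass_pos[OF r])
  have m: "0 < ?m"
    using r by (simp add: measure_ball_pos)
  have "?m \<le> D * (2 * D * ?w)"
    using doubling_D[OF r, of x] mult_left_mono[OF measure_ball_le_tent_mass[OF r, of x], of D] D_ge_1
    by linarith
  then have mw: "?m \<le> 2 * D ^ 2 * ?w"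
    by (simp add: power2_eq_square)
  have N: "\<bar>\<integral>y. tent r x y * (f y - ?c) \<partial>M\<bar> \<le> b * ?m"
    using kernel_integral_bound(2)[OF tent_measurable, of "\<lambda>y. f y - ?c" 1 r x x "2 * r"]
      tent_le_indicator[OF r, of x x "2 * r"] f osc r
    by (simp add: osc_le_def subset_ball)
  \<comment> \<open>Nonnegativity of \<open>b\<close> is extracted from the oscillation bound
    itself.\<close>
  then have "0 \<le> b * ?m"
    by linarith
  then have "0 \<le> b"
    using m by (simp add: zero_le_mult_iff)
  have "\<bar>smoothing r f x - ?c\<bar> = \<bar>\<integral>y. tent r x y * (f y - ?c) \<partial>M\<bar> / ?w"
    using w by (simp add: smoothing_minus_const[OF r f])
  also have "\<dots> \<le> b * (2 * D ^ 2 * ?w) / ?w"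
    using N mult_left_mono[OF mw \<open>0 \<le> b\<close>] w by (intro divide_right_mono) auto
  finally show ?thesis
    using w by (simp add: mult_ac)
qed

text \<open>For centres closer than \<open>r\<close> both kernels live in
  \<open>ball x (2 * r)\<close> and differ there by at most \<open>dist x x' / r\<close>. Numerators
  and masses therefore change in proportion to this ratio; subtracting the average first turns the
  numerators into oscillations.\<close>

lemma smoothing_Lipschitz:
  assumes r: "0 < r" and f: "f \<in> L1_loc M" and osc: "osc_le f x (2 * r) b"
    and near: "dist x x' < r"
  shows "\<bar>smoothing r f x - smoothing r f x'\<bar> \<le> 6 * D ^ 5 * b * (dist x x' / r)"
proof -
  let ?m = "measure M (ball x (2 * r))" and ?c = "ball_avg M f (ball x (2 * r))"
  let ?w = "tent_mass r x" and ?w' = "tent_mass r x'" and ?q = "dist x x' / r"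
  let ?N = "\<lambda>x. \<integral>y. tent r x y * (f y - ?c) \<partial>M"
  have w: "0 < ?w" "0 < ?w'"
    by (rule tent_mass_pos[OF r])+
  have m: "0 < ?m"
    using r by (simp add: measure_ball_pos)
  have "0 \<le> ?q"
    using r by simp
  have sub: "ball x r \<subseteq> ball x (2 * r)"
    using r by (simp add: subset_ball)
  have sub': "ball x' r \<subseteq> ball x (2 * r)"
  proof
    fix t assume "t \<in> ball x' r"
    then show "t \<in> ball x (2 * r)"
      using near dist_triangle[of x t x'] by simp
  qed
  have "?m \<le> D * (2 * D * ?w)"
    using doubling_D[OF r, of x] mult_left_mono[OF measure_ball_le_tent_mass[OF r, of x], of D] D_ge_1
    by linarith
  then have mw: "?m \<le> 2 * D ^ 2 * ?w"
    by (simp add: power2_eq_square)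
  \<comment> \<open>The mass about \<open>x'\<close> must be compared with the ball about
    \<open>x\<close>: two doublings bring the radius \<open>4 * r\<close> down to \<open>r\<close>,
    and passing to the tent costs a further \<open>2 * D\<close>.\<close>
  have "ball x (2 * r) \<subseteq> ball x' (4 * r)"
  proof
    fix t assume "t \<in> ball x (2 * r)"
    then show "t \<in> ball x' (4 * r)"
      using near dist_triangle[of x' t x] r by (simp add: dist_commute)
  qed
  then have "?m \<le> D ^ 2 * measure M (ball x' r)"
    using measure_ball_mono doubling_4[OF r, of x'] by (meson order_trans)
  also have "\<dots> \<le> D ^ 2 * (2 * D * ?w')"
    using measure_ball_le_tent_mass[OF r, of x'] by (intro mult_left_mono) auto
  finally have mw': "?m \<le> 2 * D ^ 3 * ?w'"
    by (simp add: power2_eq_square power3_eq_cube)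
  have P: "(LINT y:ball x (2 * r)|M. \<bar>f y - ?c\<bar>) \<le> b * ?m"
    using osc by (simp add: osc_le_def)
  have N': "\<bar>?N x'\<bar> \<le> b * ?m"
    using kernel_integral_bound(2)[OF tent_measurable, of "\<lambda>y. f y - ?c" 1 r x' x "2 * r"]
      tent_le_indicator[OF r sub'] f P by simp
  then have "0 \<le> b * ?m"
    by linarith
  then have "0 \<le> b"
    using m by (simp add: zero_le_mult_iff)
  have diff: "\<bar>\<integral>y. (tent r x y - tent r x' y) * h y \<partial>M\<bar> \<le> ?q * (LINT y:ball x (2 * r)|M. \<bar>h y\<bar>)"
    if "h \<in> L1_loc M" for h
    using that \<open>0 \<le> ?q\<close> tent_diff_le_indicator[OF r sub sub']
    by (intro kernel_integral_bound(2)) auto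
  have "?N x - ?N x' = (\<integral>y. (tent r x y - tent r x' y) * (f y - ?c) \<partial>M)"
    using integrable_tent_mult[OF r, of "\<lambda>y. f y - ?c"] f by (simp add: left_diff_distrib)
  then have "\<bar>?N x - ?N x'\<bar> \<le> ?q * (LINT y:ball x (2 * r)|M. \<bar>f y - ?c\<bar>)"
    using diff[of "\<lambda>y. f y - ?c"] f by simp
  also have "\<dots> \<le> ?q * (b * ?m)"
    using P \<open>0 \<le> ?q\<close> by (rule mult_left_mono)
  finally have NN: "\<bar>?N x - ?N x'\<bar> \<le> ?q * b * ?m"
    by simp
  have "?w - ?w' = (\<integral>y. (tent r x y - tent r x' y) * 1 \<partial>M)"
    using integrable_tent[OF r] by (simp add: tent_mass_def)
  then have ww: "\<bar>?w' - ?w\<bar> \<le> ?q * ?m"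
    using diff[of "\<lambda>_. 1"] by (simp add: set_integral_const_ball abs_minus_commute)
  have "smoothing r f x - smoothing r f x' = (smoothing r f x - ?c) - (smoothing r f x' - ?c)"
    by simp
  also have "\<dots> = ?N x / ?w - ?N x' / ?w'"
    by (simp only: smoothing_minus_const[OF r f])
  \<comment> \<open>The change of the numerator costs \<open>2 * D ^ 2\<close>. The change of the
    mass costs \<open>2 * D ^ 2\<close> times \<open>2 * D ^ 3\<close>, because both masses stand in
    the denominator. Together this is at most \<open>6 * D ^ 5\<close>.\<close>
  also have "\<dots> = (?N x - ?N x') / ?w + ?N x' * (?w' - ?w) / (?w * ?w')"
    using w by (simp add: field_simps)
  finally have "\<bar>smoothing r f x - smoothing r f x'\<bar>
      \<le> \<bar>?N x - ?N x'\<bar> / ?w + \<bar>?N x'\<bar> * \<bar>?w' - ?w\<bar> / (?w * ?w')"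
    using w abs_triangle_ineq[of "(?N x - ?N x') / ?w" "?N x' * (?w' - ?w) / (?w * ?w')"]
    by (simp add: abs_mult)
  also have "\<dots> \<le> ?q * b * (2 * D ^ 2 * ?w) / ?w
      + ?q * b * ((2 * D ^ 2 * ?w) * (2 * D ^ 3 * ?w')) / (?w * ?w')"
  proof (intro add_mono divide_right_mono)
    have "?q * b * ?m \<le> ?q * b * (2 * D ^ 2 * ?w)"
      using mw \<open>0 \<le> ?q\<close> \<open>0 \<le> b\<close> by (intro mult_left_mono mult_nonneg_nonneg)
    with NN show "\<bar>?N x - ?N x'\<bar> \<le> ?q * b * (2 * D ^ 2 * ?w)"
      by linarith
    have "\<bar>?N x'\<bar> * \<bar>?w' - ?w\<bar> \<le> (b * ?m) * (?q * ?m)"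
      using N' ww \<open>0 \<le> b * ?m\<close> by (intro mult_mono) auto
    also have "\<dots> = ?q * b * (?m * ?m)"
      by simp
    also have "\<dots> \<le> ?q * b * ((2 * D ^ 2 * ?w) * (2 * D ^ 3 * ?w'))"
      using mw mw' m w D_ge_1 \<open>0 \<le> ?q\<close> \<open>0 \<le> b\<close> by (intro mult_left_mono mult_mono mult_nonneg_nonneg) auto
    finally show "\<bar>?N x'\<bar> * \<bar>?w' - ?w\<bar> \<le> ?q * b * ((2 * D ^ 2 * ?w) * (2 * D ^ 3 * ?w'))" .
  qed (use w in auto)
  also have "\<dots> = (2 * D ^ 2 + 4 * D ^ 5) * (b * ?q)"
  proof -
    have "(2 * D ^ 2 * ?w) * (2 * D ^ 3 * ?w') = 4 * D ^ 5 * (?w * ?w')"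
      by (simp add: power_add[of D 2 3, simplified])
    then show ?thesis
      using w r by (simp add: field_simps)
  qed
  also have "\<dots> \<le> (6 * D ^ 5) * (b * ?q)"
    using power_increasing[of 2 5 D] D_ge_1 \<open>0 \<le> ?q\<close> \<open>0 \<le> b\<close>
    by (intro mult_right_mono mult_nonneg_nonneg) auto
  finally show ?thesis
    by (simp add: mult_ac)
qed

lemma smoothing_uniformly_continuous:
  assumes r: "0 < r" and f: "f \<in> L1_loc M" and osc: "\<And>x. osc_le f x (2 * r) b" and "0 < b"
  shows "uniformly_continuous_on UNIV (smoothing r f)"
  unfolding uniformly_continuous_on_def
proof (intro allI impI)
  fix e :: real assume "0 < e"
  \<comment> \<open>\<open>L\<close> is a Lipschitz constant common to all centres, valid at
    distances below \<open>r\<close>; hence the cap \<open>min r (e / L)\<close>.\<close>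
  define L where "L = 6 * D ^ 5 * b / r"
  have "0 < L"
    using r D_ge_1 \<open>0 < b\<close> by (simp add: L_def)
  show "\<exists>d>0. \<forall>x\<in>UNIV. \<forall>x'\<in>UNIV. dist x' x < d \<longrightarrow> dist (smoothing r f x') (smoothing r f x) < e"
  proof (intro exI[of _ "min r (e / L)"] conjI ballI impI)
    fix x x' :: 'a assume "dist x' x < min r (e / L)"
    then have "dist x' x < r" "L * dist x' x < e"
      using \<open>0 < L\<close> by (auto simp: field_simps)
    then show "dist (smoothing r f x') (smoothing r f x) < e"
      using smoothing_Lipschitz[OF r f osc, of x' x] by (simp add: dist_real_def L_def)
  qed (use r \<open>0 < e\<close> \<open>0 < L\<close> in auto)
qed

text \<open>On \<open>ball x r\<close> both functions are compared with the average over
  \<open>ball x (2 * r)\<close>: \<open>2 * D ^ 5\<close> for the smoothing at \<open>x\<close>,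
  \<open>6 * D ^ 5\<close> for moving from \<open>x\<close> to \<open>y\<close>, and
  \<open>D ^ 5\<close> for \<open>f\<close>. The integral is a nonnegative one because local
  integrability of the smoothing is derived later from these bounds.\<close>

lemma smoothing_local_error:
  assumes r: "0 < r" and f: "f \<in> L1_loc M" and osc: "\<And>x. osc_le f x (2 * r) b" and "0 < b"
  shows "(\<integral>\<^sup>+y\<in>ball x r. ennreal \<bar>f y - smoothing r f y\<bar> \<partial>M) \<le> ennreal (9 * D ^ 5 * b * measure M (ball x r))"
proof -
  let ?c = "ball_avg M f (ball x (2 * r))" and ?m = "measure M (ball x r)"
  have pw: "D ^ 2 \<le> D ^ 5" "D \<le> D ^ 5" "0 \<le> D ^ 5"
    using D_ge_1 power_increasing[of 2 5 D] power_increasing[of 1 5 D] by auto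
  have "\<bar>f y - smoothing r f y\<bar> \<le> \<bar>f y - ?c\<bar> + 8 * D ^ 5 * b" if "y \<in> ball x r" for y
  proof -
    have "\<bar>smoothing r f x - ?c\<bar> \<le> 2 * D ^ 2 * b"
      by (rule smoothing_approx[OF r f osc])
    also have "\<dots> \<le> 2 * D ^ 5 * b"
      using pw \<open>0 < b\<close> by simp
    finally have 1: "\<bar>smoothing r f x - ?c\<bar> \<le> 2 * D ^ 5 * b" .
    have "\<bar>smoothing r f x - smoothing r f y\<bar> \<le> 6 * D ^ 5 * b * (dist x y / r)"
      using that by (intro smoothing_Lipschitz[OF r f osc]) auto
    also have "\<dots> \<le> 6 * D ^ 5 * b * 1"
      using that r pw \<open>0 < b\<close> by (intro mult_left_mono) auto
    finally show ?thesis
      using 1 by linarith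
  qed
  then have "(\<integral>\<^sup>+y\<in>ball x r. ennreal \<bar>f y - smoothing r f y\<bar> \<partial>M)
      \<le> (\<integral>\<^sup>+y\<in>ball x r. ennreal (\<bar>f y - ?c\<bar> + 8 * D ^ 5 * b) \<partial>M)"
    by (intro nn_integral_mono) (auto simp: indicator_def intro!: ennreal_leI)
  also have "\<dots> \<le> (\<integral>\<^sup>+y. ennreal \<bar>f y - ?c\<bar> * indicator (ball x r) y
      + ennreal (8 * D ^ 5 * b) * indicator (ball x r) y \<partial>M)"
    using pw \<open>0 < b\<close> by (intro nn_integral_mono) (simp add: indicator_def)
  also have "\<dots> = (\<integral>\<^sup>+y\<in>ball x r. ennreal \<bar>f y - ?c\<bar> \<partial>M) + ennreal (8 * D ^ 5 * b) * emeasure M (ball x r)"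
    using L1_loc_borel_measurable[OF f]
    by (subst nn_integral_add) (auto simp: nn_integral_cmult_indicator)
  also have "\<dots> = ennreal ((LINT y:ball x r|M. \<bar>f y - ?c\<bar>) + 8 * D ^ 5 * b * ?m)"
    using f pw \<open>0 < b\<close>
    by (simp add: nn_integral_ball emeasure_ball set_lebesgue_integral_def flip: ennreal_mult ennreal_plus)
  also have "\<dots> \<le> ennreal (9 * D ^ 5 * b * ?m)"
  proof (rule ennreal_leI)
    have "(LINT y:ball x r|M. \<bar>f y - ?c\<bar>) \<le> (LINT y:ball x (2 * r)|M. \<bar>f y - ?c\<bar>)"
      using f r by (intro set_integral_mono_ball) (auto simp: subset_ball)
    also have "\<dots> \<le> b * measure M (ball x (2 * r))"
      using osc by (simp add: osc_le_def)
    also have "\<dots> \<le> b * (D * ?m)"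
      using doubling_D[OF r] \<open>0 < b\<close> by simp
    also have "\<dots> \<le> b * (D ^ 5 * ?m)"
      using pw \<open>0 < b\<close> by (intro mult_left_mono mult_right_mono) auto
    finally show "(LINT y:ball x r|M. \<bar>f y - ?c\<bar>) + 8 * D ^ 5 * b * ?m \<le> 9 * D ^ 5 * b * ?m"
      by (simp add: algebra_simps)
  qed
  finally show ?thesis .
qed

text \<open>Covering balls of radius \<open>r / 5\<close> have dilations of radius \<open>r\<close>,
  where the local estimate applies, and they stay in \<open>ball x (2 * s)\<close> because
  \<open>r \<le> s\<close>. The dilation costs \<open>D ^ 3\<close> and the doubled ball costs
  \<open>D\<close>. Large balls are thus controlled by the oscillation of \<open>f\<close> at the
  single scale \<open>2 * r\<close>.\<close>

lemma smoothing_large_error: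
  assumes r: "0 < r" and f: "f \<in> L1_loc M" and osc: "\<And>x. osc_le f x (2 * r) b" and "0 < b"
    and "r \<le> s"
  shows "(\<integral>\<^sup>+y\<in>ball x s. ennreal \<bar>f y - smoothing r f y\<bar> \<partial>M)
    \<le> ennreal (9 * D ^ 9 * b * measure M (ball x s))"
proof -
  have "continuous_on UNIV (smoothing r f)"
    using smoothing_uniformly_continuous[OF r f osc \<open>0 < b\<close>] by (rule uniformly_continuous_imp_continuous)
  then have [measurable]: "smoothing r f \<in> borel_measurable M" "f \<in> borel_measurable M"
    using continuous_borel_measurable L1_loc_borel_measurable[OF f] by auto
  define A where "A = 9 * D ^ 5 * b * D ^ 3"
  have "0 \<le> A"
    using D_ge_1 \<open>0 < b\<close> by (simp add: A_def)
  have "(\<integral>\<^sup>+y\<in>ball x s. ennreal \<bar>f y - smoothing r f y\<bar> \<partial>M) \<le> (\<integral>\<^sup>+y\<in>ball x (2 * s). ennreal A \<partial>M)"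
  proof (rule covering_nn_integral_le[where I = "ball x s" and r = "\<lambda>_. r / 5" and R = r])
    fix y assume y: "y \<in> ball x s"
    show "ball y (r / 5) \<subseteq> ball x (2 * s)"
    proof
      fix t assume "t \<in> ball y (r / 5)"
      then show "t \<in> ball x (2 * s)"
        using y dist_triangle[of x t y] r \<open>r \<le> s\<close> by simp
    qed
    have "(\<integral>\<^sup>+t\<in>ball x s \<inter> ball y (5 * (r / 5)). ennreal \<bar>f t - smoothing r f t\<bar> \<partial>M)
        \<le> (\<integral>\<^sup>+t\<in>ball y r. ennreal \<bar>f t - smoothing r f t\<bar> \<partial>M)"
      by (intro nn_integral_mono) (auto simp: indicator_def)
    also have "\<dots> \<le> ennreal (9 * D ^ 5 * b * measure M (ball y r))"
      by (rule smoothing_local_error[OF r f osc \<open>0 < b\<close>])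
    also have "\<dots> \<le> ennreal (9 * D ^ 5 * b * (D ^ 3 * measure M (ball y (r / 5))))"
      using doubling_8_le[of "r / 5" r y] r D_ge_1 \<open>0 < b\<close> by (intro ennreal_leI mult_left_mono) auto
    also have "\<dots> = ennreal A * emeasure M (ball y (r / 5))"
      using \<open>0 \<le> A\<close> by (simp add: emeasure_ball A_def mult.assoc flip: ennreal_mult)
    also have "\<dots> = (\<integral>\<^sup>+t\<in>ball y (r / 5). ennreal A \<partial>M)"
      by (simp add: nn_integral_cmult_indicator)
    finally show "(\<integral>\<^sup>+t\<in>ball x s \<inter> ball y (5 * (r / 5)). ennreal \<bar>f t - smoothing r f t\<bar> \<partial>M)
        \<le> (\<integral>\<^sup>+t\<in>ball y (r / 5). ennreal A \<partial>M)" .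
  next
    show "ball x s \<subseteq> (\<Union>y\<in>ball x s. ball y (r / 5))"
      using r by force
  qed (use r in auto)
  also have "\<dots> = ennreal (A * measure M (ball x (2 * s)))"
    using \<open>0 \<le> A\<close> by (simp add: nn_integral_cmult_indicator emeasure_ball ennreal_mult)
  also have "\<dots> \<le> ennreal (A * (D * measure M (ball x s)))"
    using doubling_D[of s x] r \<open>r \<le> s\<close> \<open>0 \<le> A\<close> by (intro ennreal_leI mult_left_mono) auto
  also have "A * (D * measure M (ball x s)) = 9 * (D ^ 5 * D ^ 3 * D) * b * measure M (ball x s)"
    by (simp add: A_def)
  also have "D ^ 5 * D ^ 3 * D = D ^ 9"
    by (simp flip: power_add power_Suc2)
  finally show ?thesis .
qed

lemma smoothing_L1_loc:
  assumes r: "0 < r" and f: "f \<in> L1_loc M" and osc: "\<And>x. osc_le f x (2 * r) b" and "0 < b"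
  shows "smoothing r f \<in> L1_loc M"
proof -
  have "continuous_on UNIV (smoothing r f)"
    using smoothing_uniformly_continuous[OF r f osc \<open>0 < b\<close>] by (rule uniformly_continuous_imp_continuous)
  then have [measurable]: "smoothing r f \<in> borel_measurable M" "f \<in> borel_measurable M"
    using continuous_borel_measurable L1_loc_borel_measurable[OF f] by auto
  have "set_integrable M (ball x s) (\<lambda>y. f y - smoothing r f y)" for x s
  proof (rule set_integrable_subset)
    \<comment> \<open>The error bound is available for radii at least \<open>r\<close>; smaller
      balls are contained in such a ball.\<close>
    show "set_integrable M (ball x (max r s)) (\<lambda>y. f y - smoothing r f y)"
      unfolding set_integrable_def
    proof (rule integrableI_bounded)
      have "(\<integral>\<^sup>+y. ennreal (norm (indicator (ball x (max r s)) y *\<^sub>R (f y - smoothing r f y))) \<partial>M)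
          = (\<integral>\<^sup>+y\<in>ball x (max r s). ennreal \<bar>f y - smoothing r f y\<bar> \<partial>M)"
        by (intro nn_integral_cong) (auto simp: indicator_def)
      also have "\<dots> < \<infinity>"
        using smoothing_large_error[OF r f osc \<open>0 < b\<close>, of "max r s" x] by (auto intro: le_less_trans)
      finally show "(\<integral>\<^sup>+y. ennreal (norm (indicator (ball x (max r s)) y *\<^sub>R (f y - smoothing r f y))) \<partial>M) < \<infinity>" .
    qed measurable
  qed (auto simp: subset_ball)
  then have "(\<lambda>y. f y - smoothing r f y) \<in> L1_loc M"
    by (simp add: L1_loc_def)
  then have "(\<lambda>y. f y - (f y - smoothing r f y)) \<in> L1_loc M"
    by (rule L1_loc_diff[OF f])
  then show ?thesis
    by simp
qed

text \<open>From scale \<open>r\<close> upwards the error is small in mean, so 0 serves as reference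
  constant. Below \<open>r\<close> the reference is the average of \<open>f\<close> minus the value
  of the smoothing at the centre, which splits the error into the oscillation of \<open>f\<close>
  and the variation of the smoothing. Returning to the average doubles 9 to 18.\<close>

lemma smoothing_error_osc:
  assumes r: "0 < r" and f: "f \<in> L1_loc M" and "0 < b"
    and osc: "\<And>x s. 0 < s \<Longrightarrow> s \<le> 2 * r \<Longrightarrow> osc_le f x s b" and "0 < s"
  shows "osc_le (\<lambda>y. f y - smoothing r f y) x s (18 * D ^ 9 * b)"
proof -
  have osc2: "osc_le f x (2 * r) b" for x
    using osc r by simp
  let ?g = "smoothing r f"
  have g: "?g \<in> L1_loc M"
    by (rule smoothing_L1_loc[OF r f osc2 \<open>0 < b\<close>])
  show ?thesis
  proof (cases "r \<le> s")
    case True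
    have "ennreal (LINT y:ball x s|M. \<bar>f y - ?g y - 0\<bar>) \<le> ennreal (9 * D ^ 9 * b * measure M (ball x s))"
      using smoothing_large_error[OF r f osc2 \<open>0 < b\<close> True, of x] f g
      by (subst nn_integral_ball[symmetric]) auto
    then have "(LINT y:ball x s|M. \<bar>f y - ?g y - 0\<bar>) \<le> 9 * D ^ 9 * b * measure M (ball x s)"
      using D_ge_1 \<open>0 < b\<close> by (simp add: ennreal_le_iff)
    then have "osc_le (\<lambda>y. f y - ?g y) x s (2 * (9 * D ^ 9 * b))"
      using f g \<open>0 < s\<close> by (intro osc_leI[where c = 0]) auto
    then show ?thesis
      by (simp add: mult.assoc)
  next
    case False
    let ?c = "ball_avg M f (ball x s)" and ?m = "measure M (ball x s)"
    have near: "\<bar>?g y - ?g x\<bar> \<le> 6 * D ^ 5 * b" if "y \<in> ball x s" for y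
    proof -
      have "\<bar>?g x - ?g y\<bar> \<le> 6 * D ^ 5 * b * (dist x y / r)"
        using that False by (intro smoothing_Lipschitz[OF r f osc2]) auto
      also have "\<dots> \<le> 6 * D ^ 5 * b * 1"
        using that False r D_ge_1 \<open>0 < b\<close> by (intro mult_left_mono) auto
      finally show ?thesis
        by (simp add: abs_minus_commute)
    qed
    have "(LINT y:ball x s|M. \<bar>f y - ?g y - (?c - ?g x)\<bar>) \<le> (LINT y:ball x s|M. \<bar>f y - ?c\<bar> + 6 * D ^ 5 * b)"
    proof (rule set_integral_mono)
      fix y assume "y \<in> ball x s"
      then show "\<bar>f y - ?g y - (?c - ?g x)\<bar> \<le> \<bar>f y - ?c\<bar> + 6 * D ^ 5 * b"
        using near[of y] by linarith
    qed (use f g in \<open>auto intro!: L1_locD set_integral_add\<close>)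
    also have "\<dots> = (LINT y:ball x s|M. \<bar>f y - ?c\<bar>) + 6 * D ^ 5 * b * ?m"
      using f by (subst set_integral_add) (auto intro!: L1_locD simp: set_integral_const_ball)
    also have "\<dots> \<le> b * ?m + 6 * D ^ 5 * b * ?m"
      using osc[of s x] False \<open>0 < s\<close> by (simp add: osc_le_def)
    also have "\<dots> = (1 + 6 * D ^ 5) * (b * ?m)"
      by (simp add: algebra_simps)
    also have "\<dots> \<le> (9 * D ^ 9) * (b * ?m)"
    proof (rule mult_right_mono)
      have "D ^ 5 \<le> D ^ 9" "1 \<le> D ^ 9"
        using D_ge_1 power_increasing[of 5 9 D] by auto
      then show "1 + 6 * D ^ 5 \<le> 9 * D ^ 9"
        by linarith
    qed (use \<open>0 < b\<close> in auto)
    finally have "osc_le (\<lambda>y. f y - ?g y) x s (2 * (9 * D ^ 9 * b))"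
      using f g \<open>0 < s\<close> by (intro osc_leI[where c = "?c - ?g x"]) auto
    then show ?thesis
      by (simp add: mult.assoc)
  qed
qed

section \<open>VMO^p is contained in the closure\<close>

lemma VMOp_subset_closure:
  assumes p: "1 \<le> p"
  shows "VMOp M p \<subseteq> BMO_closure M (C_u \<inter> BMO M)"
proof
  fix f assume f: "f \<in> VMOp M p"
  have fL: "f \<in> L1_loc M" and fin: "BMO_seminorm M p f < top"
    and lim: "((\<lambda>r. SUP x. SUP s\<in>{0<..r}. mean_osc M p f (ball x s)) \<longlongrightarrow> 0) (at_right 0)"
    using f by (auto simp: VMOp_def BMOp_def)
  have osc_of: "osc_le f x s (2 * t)" if "mean_osc M p f (ball x s) \<le> ennreal t" "0 < t" "0 < s" for x s t
    using that p by (intro osc_le_of_moment[OF fL _ p]) (auto simp: mean_osc_le_iff)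
  obtain c where c: "0 \<le> c" "BMO_seminorm M p f = ennreal c"
    using fin by (cases "BMO_seminorm M p f") auto
  have "BMO_seminorm M p f \<le> ennreal (c + 1)"
    using c by (simp add: ennreal_leI)
  then have "osc_le f x s (2 * (c + 1))" if "0 < s" for x s
    using that c(1) unfolding BMO_seminorm_le_iff by (intro osc_of) auto
  then have "f \<in> BMO M"
    using fL c unfolding BMO_iff by (intro conjI exI[of _ "2 * (c + 1)"]) auto
  moreover have "\<exists>g\<in>C_u \<inter> BMO M. \<forall>x s. 0 < s \<longrightarrow> osc_le (\<lambda>y. f y - g y) x s e" if "0 < e" for e
  proof -
    \<comment> \<open>Two losses are anticipated: a factor 2 from exponent \<open>p\<close> to
      exponent 1, and \<open>18 * D ^ 9\<close> from the smoothing.\<close>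
    define t where "t = e / (36 * D ^ 9)"
    have "0 < t"
      using \<open>0 < e\<close> D_ge_1 by (simp add: t_def)
    have te: "18 * D ^ 9 * (2 * t) = e"
      using D_ge_1 by (simp add: t_def)
    have "\<forall>\<^sub>F r in at_right 0. (SUP x. SUP s\<in>{0<..r}. mean_osc M p f (ball x s)) < ennreal t"
      using lim \<open>0 < t\<close> by (intro order_tendstoD(2)) auto
    then obtain d where "0 < d" and
      d: "\<And>r. 0 < r \<Longrightarrow> r < d \<Longrightarrow> (SUP x. SUP s\<in>{0<..r}. mean_osc M p f (ball x s)) < ennreal t"
      by (auto simp: eventually_at_right_field)
    \<comment> \<open>Smoothing at scale \<open>r\<close> involves oscillation up to radius
      \<open>2 * r\<close>, which must stay strictly below \<open>d\<close>.\<close>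
    define r where "r = d / 4"
    have r: "0 < r" "2 * r < d"
      using \<open>0 < d\<close> by (auto simp: r_def)
    have osc: "osc_le f x s (2 * t)" if s: "0 < s" "s \<le> 2 * r" for x s
    proof (rule osc_of[OF _ \<open>0 < t\<close> s(1)])
      have "mean_osc M p f (ball x s) \<le> (SUP s\<in>{0<..2 * r}. mean_osc M p f (ball x s))"
        using s by (intro SUP_upper) auto
      also have "\<dots> \<le> (SUP x. SUP s\<in>{0<..2 * r}. mean_osc M p f (ball x s))"
        by (rule SUP_upper) simp
      also have "\<dots> \<le> ennreal t"
        using d[of "2 * r"] r by simp
      finally show "mean_osc M p f (ball x s) \<le> ennreal t" .
    qed
    have osc2: "osc_le f x (2 * r) (2 * t)" for x
      using osc r by simp
    have b: "0 < 2 * t"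
      using \<open>0 < t\<close> by simp
    let ?g = "smoothing r f"
    have err: "osc_le (\<lambda>y. f y - ?g y) x s e" if "0 < s" for x s
      using smoothing_error_osc[OF r(1) fL b osc that] te by simp
    have g: "?g \<in> L1_loc M"
      by (rule smoothing_L1_loc[OF r(1) fL osc2 b])
    \<comment> \<open>That the smoothing lies in \<open>BMO M\<close> is read off from
      \<open>f\<close> and the error.\<close>
    then have "(\<lambda>y. f y - ?g y) \<in> BMO M"
      unfolding BMO_iff using fL err \<open>0 < e\<close> by (intro conjI exI[of _ e]) auto
    then have "(\<lambda>y. f y - (f y - ?g y)) \<in> BMO M"
      by (rule BMO_diff[OF \<open>f \<in> BMO M\<close>])
    then have "?g \<in> BMO M"
      by simp
    moreover have "?g \<in> C_u"
      using smoothing_uniformly_continuous[OF r(1) fL osc2 b] by (simp add: C_u_def)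
    ultimately show ?thesis
      using err by blast
  qed
  ultimately show "f \<in> BMO_closure M (C_u \<inter> BMO M)"
    unfolding BMO_closure_iff[OF C_u_BMO_L1_loc] by blast
qed

end

theorem theorem3p9:
  fixes M :: "'a::metric_space measure" and p :: real
  assumes "doubling_metric_measure_space M"
    and "1 \<le> p"
  shows "VMOp M p = BMO_closure M (C_u \<inter> BMO M)"
proof -
  interpret doubling_metric_measure_space M
    by (rule assms(1))
  obtain D :: real where D: "1 \<le> D"
    "\<And>x r. 0 < r \<Longrightarrow> emeasure M (ball x (2 * r)) \<le> ennreal D * emeasure M (ball x r)"
    using doubling by blast
  interpret doubling_const M D
  proof
    fix r :: real and x assume "0 < r"
    then have "ennreal (measure M (ball x (2 * r))) \<le> ennreal (D * measure M (ball x r))"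
      using D by (simp add: emeasure_ball ennreal_mult)
    then show "measure M (ball x (2 * r)) \<le> D * measure M (ball x r)"
      using D(1) by (simp add: ennreal_le_iff)
  qed (rule D(1))
  show ?thesis
    using VMOp_subset_closure[OF assms(2)] closure_subset_VMOp[OF assms(2)] by blast
qed

end
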